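(* Consider the semi-discrete strip PML equation in Laplace space, in each of the two elements $\Omega^\mp$, $$\mathbf P^{-1}(sS_x)\widetilde{\mathbf Q}=\tfrac12\Big(\mathbf A_x\mathbf D_x-\mathbf H_x^{-1}\mathbf A_x\mathbf D_x^T\mathbf H_x+\mathbf H_x^{-1}\mathbf A_x\big(\mathbf B_x(1,1)-\mathbf B_x(-1,-1)\big)\Big)\widetilde{\mathbf Q}-\mathbf H_x^{-1}\big(\mathbf e_x(-1)\widetilde{\mathbf{FL}}_x+\mathbf e_x(1)\widetilde{\mathbf{FR}}_x\big)+\mathbf P^{-1}\widetilde{\mathbf F},$$ with $d_x=d\ge0$, $\alpha_x=\alpha\ge0$, $S_x=1+\frac{d}{s+\alpha}$ and $\Re(s)\ge a>0$. Then $\Re(sS_x)\ge a>0$ and $$\|\sqrt{\Re(sS_x)}\widetilde{\mathbf Q}^-(s)\|_{hP}^2+\|\sqrt{\Re(sS_x)}\widetilde{\mathbf Q}^+(s)\|_{hP}^2\le\|\widetilde{\mathbf Q}^-(s)\|_{hP}\|\widetilde{\mathbf F}^-(s)\|_{hP}+\|\widetilde{\mathbf Q}^+(s)\|_{hP}\|\widetilde{\mathbf F}^+(s)\|_{hP}+\widetilde{\mathrm{BT}}_h,$$ $$\widetilde{\mathrm{BT}}_h=\mathcal{BT}_s^-+\mathcal{BT}_s^++\mathcal{IT}_s+\mathcal F_{luc}^-+\mathcal F_{luc}^+\le0,$$ where the surface terms are $$\mathcal{BT}_s^-=-\tfrac{\Delta y}2\tfrac{\Delta z}2\sum_{i,k=1}^{N+1}\sum_{\eta=x,y,z}\Big(\widehat{\widetilde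 T}{}_\eta^{-*}\widehat{\widetilde v}{}_\eta^-\Big|_{-1}\Big)_{ik}h_ih_k,\qquad \mathcal{BT}_s^+=\tfrac{\Delta y}2\tfrac{\Delta z}2\sum_{i,k=1}^{N+1}\sum_{\eta=x,y,z}\Big(\widehat{\widetilde T}{}_\eta^{+*}\widehat{\widetilde v}{}_\eta^+\Big|_{1}\Big)_{ik}h_ih_k,$$ $$\mathcal{IT}_s=-\tfrac{\Delta y}2\tfrac{\Delta z}2\sum_{i,k=1}^{N+1}\sum_{\eta=x,y,z}\Big(\widehat{\widetilde T}{}_\eta^{*}(\widehat{\widetilde v}{}_\eta^+-\widehat{\widetilde v}{}_\eta^-)\Big)_{ik}h_ih_k,$$ $$\mathcal F_{luc}^\pm=-\tfrac{\Delta y}2\tfrac{\Delta z}2\sum_{\eta=x,y,z}\sum_{i,k=1}^{N+1}\Big(\tfrac1{Z_\eta^\pm}|\widetilde G_\eta^\pm|^2\Big|_{-1}+\tfrac1{Z_\eta^\pm}|\widetilde G_\eta^\pm|^2\Big|_{1}\Big)_{ik}h_ih_k .$$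
   Context: **Elements and quadrature.** The domain is split into two box elements $\Omega^-$ (for $x<0$) and $\Omega^+$ (for $x>0$) sharing the face $x=0$, with edge lengths $\Delta x,\Delta y,\Delta z>0$, each mapped affinely to $[-1,1]^3$; $|_{\pm1}$ refers to the faces at reference coordinate $\pm1$ in the $x$-direction. Let $N$ be the polynomial degree, and $q_1,\dots,q_{N+1}\in[-1,1]$ nodes with weights $h_i>0$ of a quadrature rule exact for polynomials of degree $\le2N-1$. Let $\mathcal L_i$ be the Lagrange polynomials of these nodes, $H=\mathrm{diag}(h_i)$, $\mathcal Q_{ij}=\int_{-1}^1\mathcal L_i\mathcal L_j'$, $D=H^{-1}\mathcal Q$, $e(\psi)=(\mathcal L_1(\psi),\dots,\mathcal L_{N+1}(\psi))^T$. With $I$ the $(N+1)\times(N+1)$ identity and $I_9$ the $9\times9$ identity: $\mathbf D_x=\frac2{\Delta x}I_9\otimes D\otimes I\otimes I$, $\mathbf H_x=\frac{\Delta x}2I_9\otimes H\otimes I\otimes I$, $\mathbf H_y=\frac{\Delta y}2I_9\otimes I\otimes H\otimes I$, $\mathbf H_z=\frac{\Delta z}2I_9\otimes I\otimes I\otimes H$, $\mathbf H=\mathbf H_x\mathbf H_y\mathbf H_z$, $\mathbf e_x(\psi)=I_9\otimes e(\psi)\otimes I\otimes I$, $\mathbf B_x(\psi,\psi)=\mathbf e_x(\psi)\mathbf e_x(\psi)^T$. **Coefficients.** In each element the unknown $\widetilde{\mathbf Q}\in\mathbb C^{9(N+1)^3}$ collects nodal values of $(\mathbf v,\boldsymbol\sigma)$,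 with velocity $\mathbf v\in\mathbb C^3$ and stress $\boldsymbol\sigma=(\sigma_{xx},\sigma_{yy},\sigma_{zz},\sigma_{xy},\sigma_{xz},\sigma_{yz})$. In the discrete equation $\mathbf P$ stands for $P\otimes I\otimes I\otimes I$ and $\mathbf A_x$ for $A_x\otimes I\otimes I\otimes I$, with $P=\mathrm{diag}(\rho^{-1}\mathbf1_3,\mathbf C)$ symmetric positive definite (per element; $\rho>0$ the density, $\mathbf C$ the symmetric positive definite $6\times6$ elastic stiffness matrix) and $A_x=\begin{pmatrix}\mathbf0&\mathbf a_x\\ \mathbf a_x^T&\mathbf0\end{pmatrix}$, $\mathbf a_x\boldsymbol\sigma=(\sigma_{xx},\sigma_{xy},\sigma_{xz})$. The impedances are $Z_\eta=\rho c_\eta>0$, with $c_x=c_p$ and $c_y=c_z=c_s$ (P- and S-wave speeds); $\mathbf Z=\mathrm{diag}(Z_x,Z_y,Z_z)$. The source is $\widetilde{\mathbf F}=\mathbf P\big(S_x\widetilde{\mathbf F}_Q-\frac d{s+\alpha}\widetilde{\mathbf F}_{w_x}\big)$ with given $\widetilde{\mathbf F}_Q,\widetilde{\mathbf F}_{w_x}$. **Fluxes.** On the face at $\psi=\pm1$, the trace $\mathbf e_x(\psi)^T\widetilde{\mathbf Q}$ gives at each face node $(i,k)$ values $\widetilde{\mathbf v},\widetilde{\boldsymbol\sigma}$ and the traction $\widetilde{\mathbf T}=\mathbf a_x\widetilde{\boldsymbol\sigma}$. The hat-variables at each face node solve the Riemann problem constrained by the boundary/interface conditions. At the external face $\psi=1$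 (of $\Omega^+$): $Z_\eta\widehat{\widetilde v}_\eta-\widehat{\widetilde T}_\eta=Z_\eta\widetilde v_\eta-\widetilde T_\eta$ and $\frac{Z_\eta}2(1-\gamma_\eta)\widehat{\widetilde v}_\eta+\frac{1+\gamma_\eta}2\widehat{\widetilde T}_\eta=0$. At the external face $\psi=-1$ (of $\Omega^-$): $Z_\eta\widehat{\widetilde v}_\eta+\widehat{\widetilde T}_\eta=Z_\eta\widetilde v_\eta+\widetilde T_\eta$ and $\frac{Z_\eta}2(1-\gamma_\eta)\widehat{\widetilde v}_\eta-\frac{1+\gamma_\eta}2\widehat{\widetilde T}_\eta=0$; $\gamma_\eta$ real, $|\gamma_\eta|\le1$. At the interface ($\psi=1$ face of $\Omega^-$, $\psi=-1$ face of $\Omega^+$): $\widehat{\widetilde v}{}^+_\eta=\widehat{\widetilde v}{}^-_\eta$, $\widehat{\widetilde T}{}^+_\eta=\widehat{\widetilde T}{}^-_\eta=\widehat{\widetilde T}_\eta$, $Z^-_\eta\widehat{\widetilde v}{}^-_\eta-\widehat{\widetilde T}_\eta=Z^-_\eta\widetilde v^-_\eta-\widetilde T^-_\eta$, $Z^+_\eta\widehat{\widetilde v}{}^+_\eta+\widehat{\widetilde T}_\eta=Z^+_\eta\widetilde v^+_\eta+\widetilde T^+_\eta$. Put $\widetilde G_\eta=\frac12Z_\eta(\widetilde v_\eta-\widehat{\widetilde v}_\eta)\pm\frac12(\widetilde T_\eta-\widehat{\widetilde T}_\eta)$ at $\psi=\pm1$, $\widetilde{\mathbf G}=(\widetilde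 G_x,\widetilde G_y,\widetilde G_z)^T$, $\widetilde{\mathbf{FL}}_x=\begin{pmatrix}\widetilde{\mathbf G}\\-\mathbf a_x^T\mathbf Z^{-1}\widetilde{\mathbf G}\end{pmatrix}$ at $\psi=-1$, $\widetilde{\mathbf{FR}}_x=\begin{pmatrix}\widetilde{\mathbf G}\\ \mathbf a_x^T\mathbf Z^{-1}\widetilde{\mathbf G}\end{pmatrix}$ at $\psi=1$ (node by node). **Norm.** $\langle\widetilde{\mathbf Q},\widetilde{\mathbf F}\rangle_{hP}=\frac12\widetilde{\mathbf Q}^\dagger\mathbf H\mathbf P^{-1}\widetilde{\mathbf F}$ and $\|\widetilde{\mathbf Q}\|_{hP}^2=\langle\widetilde{\mathbf Q},\widetilde{\mathbf Q}\rangle_{hP}$ in each element; $*$ is complex conjugation, $\dagger$ the conjugate transpose, and superscripts $\pm$ denote the element.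
   Formalization: The surface term enters the energy inequality as BT_h/2 instead of BT_h: since the hP-norm contains the factor 1/2, the inequality with BT_h is false (e.g. N=0, constant velocity, unit material, γ=0, d=α=0, s=1); BT_h ≤ 0 is stated as BT_h real and nonpositive. *)

theory Defs
  imports "HOL-Analysis.Analysis" "HOL-Computational_Algebra.Polynomial"
begin

subsection \<open>Index types\<close>

datatype axis = X | Y | Z

datatype stress = XX | YY | ZZ | XY | XZ | YZ

instance axis :: finite
proof
  have "(UNIV :: axis set) \<subseteq> {X, Y, Z}"
    using axis.exhaust by blast
  then show "finite (UNIV :: axis set)"
    by (rule finite_subset) simp
qed

instance stress :: finite
proof
  have "(UNIV :: stress set) \<subseteq> {XX, YY, ZZ, XY, XZ, YZ}"
    using stress.exhaust by blast
  then show "finite (UNIV :: stress set)"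
    by (rule finite_subset) simp
qed

text \<open>The nine unknowns are indexed by \<open>axis + stress\<close> (velocities \<open>Inl\<close>, stresses \<open>Inr\<close>).
  The $N+1$ one-dimensional nodes are indexed by a finite type \<open>'n\<close>, so an element vector has
  the index (field, x-node, y-node, z-node). On a face orthogonal to the x-direction
  the x-node is replaced by the one-point type \<open>1\<close>.\<close>

type_synonym 'n dof = "(axis + stress) \<times> 'n \<times> 'n \<times> 'n"
type_synonym 'n face_dof = "(axis + stress) \<times> 1 \<times> 'n \<times> 'n"
type_synonym 'n face_vec = "'n \<Rightarrow> 'n \<Rightarrow> complex ^ axis"

subsection \<open>Linear algebra\<close>

definition kron :: "'a::times ^ 'm ^ 'k \<Rightarrow> 'a ^ 'q ^ 'p \<Rightarrow> 'a ^ ('m \<times> 'q) ^ ('k \<times> 'p)"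
    (infixr "\<otimes>" 75) where
  "A \<otimes> B = (\<chi> i j. A $ fst i $ fst j * B $ snd i $ snd j)"

definition diag :: "('n \<Rightarrow> 'a::zero) \<Rightarrow> 'a ^ 'n ^ 'n" where
  "diag d = (\<chi> i j. if i = j then d i else 0)"

definition block_mat :: "'a ^ 'm ^ 'p \<Rightarrow> 'a ^ 'k ^ 'p \<Rightarrow> 'a ^ 'm ^ 'q \<Rightarrow> 'a ^ 'k ^ 'q
    \<Rightarrow> 'a ^ ('m + 'k) ^ ('p + 'q)" where
  "block_mat A B C D = (\<chi> i j.
     case i of
       Inl a \<Rightarrow> (case j of Inl b \<Rightarrow> A $ a $ b | Inr b \<Rightarrow> B $ a $ b)
     | Inr a \<Rightarrow> (case j of Inl b \<Rightarrow> C $ a $ b | Inr b \<Rightarrow> D $ a $ b))"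

definition block_vec :: "'a ^ 'p \<Rightarrow> 'a ^ 'q \<Rightarrow> 'a ^ ('p + 'q)" where
  "block_vec u w = (\<chi> i. case i of Inl a \<Rightarrow> u $ a | Inr b \<Rightarrow> w $ b)"

definition cmat :: "real ^ 'm ^ 'k \<Rightarrow> complex ^ 'm ^ 'k" where
  "cmat A = (\<chi> i j. complex_of_real (A $ i $ j))"

definition sym_pos_def :: "real ^ 'n ^ 'n \<Rightarrow> bool" where
  "sym_pos_def A \<longleftrightarrow> transpose A = A \<and> (\<forall>x. x \<noteq> 0 \<longrightarrow> x \<bullet> (A *v x) > 0)"

subsection \<open>Quadrature and one-dimensional operators\<close>

definition is_quadrature :: "nat \<Rightarrow> ('n::finite \<Rightarrow> real) \<Rightarrow> ('n \<Rightarrow> real) \<Rightarrow> bool" where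
  "is_quadrature N q h \<longleftrightarrow>
     CARD('n) = N + 1 \<and> inj q \<and> (\<forall>i. q i \<in> {-1..1}) \<and> (\<forall>i. h i > 0) \<and>
     (\<forall>p :: real poly. int (degree p) \<le> 2 * int N - 1 \<longrightarrow>
        (\<Sum>i\<in>UNIV. h i * poly p (q i)) = integral {-1..1} (poly p))"

definition lagrange :: "('n::finite \<Rightarrow> real) \<Rightarrow> 'n \<Rightarrow> real poly" where
  "lagrange q i = (\<Prod>j\<in>UNIV - {i}. smult (1 / (q i - q j)) [:- q j, 1:])"

definition H1 :: "('n::finite \<Rightarrow> real) \<Rightarrow> real ^ 'n ^ 'n" where
  "H1 h = diag h"

definition Q1 :: "('n::finite \<Rightarrow> real) \<Rightarrow> real ^ 'n ^ 'n" where
  "Q1 q = (\<chi> i j. integral {-1..1} (\<lambda>x. poly (lagrange q i) x * poly (pderiv (lagrange q j)) x))"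

definition D1 :: "('n::finite \<Rightarrow> real) \<Rightarrow> ('n \<Rightarrow> real) \<Rightarrow> real ^ 'n ^ 'n" where
  "D1 q h = matrix_inv (H1 h) ** Q1 q"

definition e1 :: "('n::finite \<Rightarrow> real) \<Rightarrow> real \<Rightarrow> real ^ 1 ^ 'n" where
  "e1 q \<psi> = (\<chi> i j. poly (lagrange q i) \<psi>)"

subsection \<open>Element operators\<close>

definition Dx :: "real \<Rightarrow> ('n::finite \<Rightarrow> real) \<Rightarrow> ('n \<Rightarrow> real) \<Rightarrow> real ^ 'n dof ^ 'n dof" where
  "Dx \<Delta>x q h = (2 / \<Delta>x) *\<^sub>R (mat 1 \<otimes> D1 q h \<otimes> mat 1 \<otimes> mat 1)"

definition Hx :: "real \<Rightarrow> ('n::finite \<Rightarrow> real) \<Rightarrow> real ^ 'n dof ^ 'n dof" where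
  "Hx \<Delta>x h = (\<Delta>x / 2) *\<^sub>R (mat 1 \<otimes> H1 h \<otimes> mat 1 \<otimes> mat 1)"

definition Hy :: "real \<Rightarrow> ('n::finite \<Rightarrow> real) \<Rightarrow> real ^ 'n dof ^ 'n dof" where
  "Hy \<Delta>y h = (\<Delta>y / 2) *\<^sub>R (mat 1 \<otimes> mat 1 \<otimes> H1 h \<otimes> mat 1)"

definition Hz :: "real \<Rightarrow> ('n::finite \<Rightarrow> real) \<Rightarrow> real ^ 'n dof ^ 'n dof" where
  "Hz \<Delta>z h = (\<Delta>z / 2) *\<^sub>R (mat 1 \<otimes> mat 1 \<otimes> mat 1 \<otimes> H1 h)"

definition Hxyz :: "real \<Rightarrow> real \<Rightarrow> real \<Rightarrow> ('n::finite \<Rightarrow> real) \<Rightarrow> real ^ 'n dof ^ 'n dof" where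
  "Hxyz \<Delta>x \<Delta>y \<Delta>z h = Hx \<Delta>x h ** Hy \<Delta>y h ** Hz \<Delta>z h"

definition ex :: "('n::finite \<Rightarrow> real) \<Rightarrow> real \<Rightarrow> real ^ 'n face_dof ^ 'n dof" where
  "ex q \<psi> = mat 1 \<otimes> e1 q \<psi> \<otimes> mat 1 \<otimes> mat 1"

definition Bx :: "('n::finite \<Rightarrow> real) \<Rightarrow> real \<Rightarrow> real ^ 'n dof ^ 'n dof" where
  "Bx q \<psi> = ex q \<psi> ** transpose (ex q \<psi>)"

subsection \<open>Material data\<close>

text \<open>Density, stiffness, and the P- and S-wave speeds. The stiffness matrix may be anisotropic;
  the wave speeds, which only enter through the impedances, are not tied to it.\<close>

record medium =
  dens :: real
  stiff :: "real ^ stress ^ stress"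
  c_p :: real
  c_s :: real

definition valid_medium :: "medium \<Rightarrow> bool" where
  "valid_medium M \<longleftrightarrow> dens M > 0 \<and> sym_pos_def (stiff M) \<and> c_p M > 0 \<and> c_s M > 0"

fun wave_speed :: "medium \<Rightarrow> axis \<Rightarrow> real" where
  "wave_speed M X = c_p M"
| "wave_speed M Y = c_s M"
| "wave_speed M Z = c_s M"

definition impedance :: "medium \<Rightarrow> axis \<Rightarrow> real" where
  "impedance M \<eta> = dens M * wave_speed M \<eta>"

definition Zmat :: "medium \<Rightarrow> real ^ axis ^ axis" where
  "Zmat M = diag (impedance M)"

definition P9 :: "medium \<Rightarrow> real ^ (axis + stress) ^ (axis + stress)" where
  "P9 M = block_mat (mat (inverse (dens M))) 0 0 (stiff M)"

fun traction_component :: "axis \<Rightarrow> stress" where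
  "traction_component X = XX"
| "traction_component Y = XY"
| "traction_component Z = XZ"

definition a_x :: "real ^ stress ^ axis" where
  "a_x = (\<chi> \<eta> m. if m = traction_component \<eta> then 1 else 0)"

definition A9 :: "real ^ (axis + stress) ^ (axis + stress)" where
  "A9 = block_mat 0 a_x (transpose a_x) 0"

definition Pmat :: "medium \<Rightarrow> real ^ 'n::finite dof ^ 'n dof" where
  "Pmat M = P9 M \<otimes> mat 1 \<otimes> mat 1 \<otimes> mat 1"

definition Ax :: "real ^ 'n::finite dof ^ 'n dof" where
  "Ax = A9 \<otimes> mat 1 \<otimes> mat 1 \<otimes> mat 1"

subsection \<open>Discrete norm\<close>

definition hP_inner :: "real \<Rightarrow> real \<Rightarrow> real \<Rightarrow> ('n::finite \<Rightarrow> real) \<Rightarrow> medium \<Rightarrow>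
    complex ^ 'n dof \<Rightarrow> complex ^ 'n dof \<Rightarrow> complex" where
  "hP_inner \<Delta>x \<Delta>y \<Delta>z h M Q F =
     1/2 * (\<Sum>i\<in>UNIV. cnj (Q $ i) * (cmat (Hxyz \<Delta>x \<Delta>y \<Delta>z h ** matrix_inv (Pmat M)) *v F) $ i)"

definition hP_norm :: "real \<Rightarrow> real \<Rightarrow> real \<Rightarrow> ('n::finite \<Rightarrow> real) \<Rightarrow> medium \<Rightarrow>
    complex ^ 'n dof \<Rightarrow> real" where
  "hP_norm \<Delta>x \<Delta>y \<Delta>z h M Q = sqrt (Re (hP_inner \<Delta>x \<Delta>y \<Delta>z h M Q Q))"

subsection \<open>Traces, hat-variables and fluxes\<close>

definition trace_x :: "('n::finite \<Rightarrow> real) \<Rightarrow> real \<Rightarrow> complex ^ 'n dof \<Rightarrow> complex ^ 'n face_dof" where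
  "trace_x q \<psi> Q = transpose (cmat (ex q \<psi>)) *v Q"

definition vel :: "('n::finite \<Rightarrow> real) \<Rightarrow> real \<Rightarrow> complex ^ 'n dof \<Rightarrow> 'n face_vec" where
  "vel q \<psi> Q i k = (\<chi> \<eta>. trace_x q \<psi> Q $ (Inl \<eta>, 1, i, k))"

definition trac :: "('n::finite \<Rightarrow> real) \<Rightarrow> real \<Rightarrow> complex ^ 'n dof \<Rightarrow> 'n face_vec" where
  "trac q \<psi> Q i k = cmat a_x *v (\<chi> m. trace_x q \<psi> Q $ (Inr m, 1, i, k))"

text \<open>In the following, \<open>v\<close> and \<open>T\<close> are the traces of velocity and traction, \<open>vh\<close> and \<open>Th\<close> the
  hat-variables, and \<open>Zi\<close> the impedances.\<close>

definition hat_right_boundary :: "(axis \<Rightarrow> real) \<Rightarrow> (axis \<Rightarrow> real) \<Rightarrow> 'n face_vec \<Rightarrow> 'n face_vec \<Rightarrow>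
    'n face_vec \<Rightarrow> 'n face_vec \<Rightarrow> bool" where
  "hat_right_boundary Zi \<gamma> v T vh Th \<longleftrightarrow> (\<forall>i k \<eta>.
     of_real (Zi \<eta>) * vh i k $ \<eta> - Th i k $ \<eta> = of_real (Zi \<eta>) * v i k $ \<eta> - T i k $ \<eta> \<and>
     of_real (Zi \<eta> / 2 * (1 - \<gamma> \<eta>)) * vh i k $ \<eta> + of_real ((1 + \<gamma> \<eta>) / 2) * Th i k $ \<eta> = 0)"

definition hat_left_boundary :: "(axis \<Rightarrow> real) \<Rightarrow> (axis \<Rightarrow> real) \<Rightarrow> 'n face_vec \<Rightarrow> 'n face_vec \<Rightarrow>
    'n face_vec \<Rightarrow> 'n face_vec \<Rightarrow> bool" where
  "hat_left_boundary Zi \<gamma> v T vh Th \<longleftrightarrow> (\<forall>i k \<eta>.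
     of_real (Zi \<eta>) * vh i k $ \<eta> + Th i k $ \<eta> = of_real (Zi \<eta>) * v i k $ \<eta> + T i k $ \<eta> \<and>
     of_real (Zi \<eta> / 2 * (1 - \<gamma> \<eta>)) * vh i k $ \<eta> - of_real ((1 + \<gamma> \<eta>) / 2) * Th i k $ \<eta> = 0)"

definition hat_interface :: "(axis \<Rightarrow> real) \<Rightarrow> (axis \<Rightarrow> real) \<Rightarrow> 'n face_vec \<Rightarrow> 'n face_vec \<Rightarrow>
    'n face_vec \<Rightarrow> 'n face_vec \<Rightarrow> 'n face_vec \<Rightarrow> 'n face_vec \<Rightarrow> 'n face_vec \<Rightarrow> bool" where
  "hat_interface Zm Zp vm Tm vp Tp vhm vhp Th \<longleftrightarrow> (\<forall>i k \<eta>.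
     vhp i k $ \<eta> = vhm i k $ \<eta> \<and>
     of_real (Zm \<eta>) * vhm i k $ \<eta> - Th i k $ \<eta> = of_real (Zm \<eta>) * vm i k $ \<eta> - Tm i k $ \<eta> \<and>
     of_real (Zp \<eta>) * vhp i k $ \<eta> + Th i k $ \<eta> = of_real (Zp \<eta>) * vp i k $ \<eta> + Tp i k $ \<eta>)"

text \<open>The sign \<open>\<plusminus>\<close> at the face \<open>\<psi> = \<plusminus>1\<close> is the number \<open>\<psi>\<close> itself.\<close>

definition fluctuation :: "real \<Rightarrow> (axis \<Rightarrow> real) \<Rightarrow> 'n face_vec \<Rightarrow> 'n face_vec \<Rightarrow>
    'n face_vec \<Rightarrow> 'n face_vec \<Rightarrow> 'n face_vec" where
  "fluctuation \<psi> Zi v T vh Th i k = (\<chi> \<eta>.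
     1/2 * of_real (Zi \<eta>) * (v i k $ \<eta> - vh i k $ \<eta>) + of_real \<psi> * (1/2) * (T i k $ \<eta> - Th i k $ \<eta>))"

definition FL :: "medium \<Rightarrow> 'n::finite face_vec \<Rightarrow> complex ^ 'n face_dof" where
  "FL M G = (\<chi> p. case p of (f, u, i, k) \<Rightarrow>
     block_vec (G i k) (- (cmat (transpose a_x ** matrix_inv (Zmat M)) *v G i k)) $ f)"

definition FR :: "medium \<Rightarrow> 'n::finite face_vec \<Rightarrow> complex ^ 'n face_dof" where
  "FR M G = (\<chi> p. case p of (f, u, i, k) \<Rightarrow>
     block_vec (G i k) (cmat (transpose a_x ** matrix_inv (Zmat M)) *v G i k) $ f)"

subsection \<open>The semi-discrete strip PML equation in Laplace space\<close>

definition pml_S :: "real \<Rightarrow> real \<Rightarrow> complex \<Rightarrow> complex" where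
  "pml_S d \<alpha> s = 1 + of_real d / (s + of_real \<alpha>)"

definition pml_source :: "real \<Rightarrow> real \<Rightarrow> complex \<Rightarrow> medium \<Rightarrow> complex ^ 'n::finite dof \<Rightarrow>
    complex ^ 'n dof \<Rightarrow> complex ^ 'n dof" where
  "pml_source d \<alpha> s M FQ Fw =
     cmat (Pmat M) *v (pml_S d \<alpha> s *s FQ - (of_real d / (s + of_real \<alpha>)) *s Fw)"

text \<open>\<open>GL\<close> and \<open>GR\<close> are the fluctuations on the faces \<open>\<psi> = -1\<close> and \<open>\<psi> = 1\<close> of the element.\<close>

definition pml_equation :: "real \<Rightarrow> ('n::finite \<Rightarrow> real) \<Rightarrow> ('n \<Rightarrow> real) \<Rightarrow> real \<Rightarrow> real \<Rightarrow> complex \<Rightarrow>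
    medium \<Rightarrow> complex ^ 'n dof \<Rightarrow> 'n face_vec \<Rightarrow> 'n face_vec \<Rightarrow> complex ^ 'n dof \<Rightarrow> bool" where
  "pml_equation \<Delta>x q h d \<alpha> s M Q GL GR F \<longleftrightarrow>
     cmat (matrix_inv (Pmat M)) *v ((s * pml_S d \<alpha> s) *s Q) =
       cmat ((1/2) *\<^sub>R (Ax ** Dx \<Delta>x q h
               - matrix_inv (Hx \<Delta>x h) ** Ax ** transpose (Dx \<Delta>x q h) ** Hx \<Delta>x h
               + matrix_inv (Hx \<Delta>x h) ** Ax ** (Bx q 1 - Bx q (-1)))) *v Q
       - cmat (matrix_inv (Hx \<Delta>x h)) *v
           (cmat (ex q (-1)) *v FL M GL + cmat (ex q 1) *v FR M GR)
       + cmat (matrix_inv (Pmat M)) *v F"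

subsection \<open>Surface terms\<close>

text \<open>Normalization: the discrete norm contains the factor 1/2 but the surface terms below do not.
  Multiplying the equation by $Q^\dagger H$, taking real parts and adding the two elements gives
  $2 \Re(s S_x) \sum \|Q\|^2 = 2 \Re \sum \langle Q, F \rangle + BT$, with $BT$ the sum of
  \<open>BT_minus\<close>, \<open>BT_plus\<close>, \<open>IT\<close> and the two \<open>F_luc\<close>. Hence $BT$ enters an energy estimate in this
  norm with the weight 1/2; with weight 1 the estimate is false, since $BT$ can be negative while
  the Cauchy-Schwarz step is an equality.\<close>

definition face_sum :: "real \<Rightarrow> real \<Rightarrow> ('n::finite \<Rightarrow> real) \<Rightarrow> ('n \<Rightarrow> 'n \<Rightarrow> axis \<Rightarrow> complex) \<Rightarrow> complex" where
  "face_sum \<Delta>y \<Delta>z h g =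
     of_real (\<Delta>y / 2 * (\<Delta>z / 2)) * (\<Sum>i\<in>UNIV. \<Sum>k\<in>UNIV. \<Sum>\<eta>\<in>UNIV. g i k \<eta> * of_real (h i * h k))"

definition BT_minus :: "real \<Rightarrow> real \<Rightarrow> ('n::finite \<Rightarrow> real) \<Rightarrow> 'n face_vec \<Rightarrow> 'n face_vec \<Rightarrow> complex" where
  "BT_minus \<Delta>y \<Delta>z h vh Th = - face_sum \<Delta>y \<Delta>z h (\<lambda>i k \<eta>. cnj (Th i k $ \<eta>) * vh i k $ \<eta>)"

definition BT_plus :: "real \<Rightarrow> real \<Rightarrow> ('n::finite \<Rightarrow> real) \<Rightarrow> 'n face_vec \<Rightarrow> 'n face_vec \<Rightarrow> complex" where
  "BT_plus \<Delta>y \<Delta>z h vh Th = face_sum \<Delta>y \<Delta>z h (\<lambda>i k \<eta>. cnj (Th i k $ \<eta>) * vh i k $ \<eta>)"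

definition IT :: "real \<Rightarrow> real \<Rightarrow> ('n::finite \<Rightarrow> real) \<Rightarrow> 'n face_vec \<Rightarrow> 'n face_vec \<Rightarrow> 'n face_vec \<Rightarrow> complex" where
  "IT \<Delta>y \<Delta>z h vhm vhp Th =
     - face_sum \<Delta>y \<Delta>z h (\<lambda>i k \<eta>. cnj (Th i k $ \<eta>) * (vhp i k $ \<eta> - vhm i k $ \<eta>))"

definition F_luc :: "real \<Rightarrow> real \<Rightarrow> ('n::finite \<Rightarrow> real) \<Rightarrow> (axis \<Rightarrow> real) \<Rightarrow> 'n face_vec \<Rightarrow> 'n face_vec \<Rightarrow> complex" where
  "F_luc \<Delta>y \<Delta>z h Zi GL GR =
     - face_sum \<Delta>y \<Delta>z h (\<lambda>i k \<eta>.
         of_real (1 / Zi \<eta> * (cmod (GL i k $ \<eta>))\<^sup>2 + 1 / Zi \<eta> * (cmod (GR i k $ \<eta>))\<^sup>2))"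

end

theory Submission
  imports Defs
begin

text \<open>This is the energy method. In each element, multiply the equation from the left by
  \<open>Q\<^sup>\<dagger> H\<close> and take real parts.

  The volume terms vanish (\<open>volume_term_skew\<close>). All the factors of \<open>H\<close>, \<open>A\<^sub>x\<close> and \<open>D\<^sub>x\<close> are Kronecker
  products, so factors that act on different tensor slots commute; after moving \<open>H\<close> through, the
  second derivative term is the transpose of the first, and their difference is a real
  skew-symmetric matrix, whose Hermitian form is purely imaginary.

  The boundary and flux terms live on the two faces, because \<open>H H\<^sub>x\<^sup>-\<^sup>1\<close> passes through the extension
  operator \<open>e\<^sub>x(\<psi>)\<close> and becomes a weight on the face nodes (\<open>Wyz_trace\<close>, \<open>cdot_Wface\<close>). At one face
  node the boundary term contributes \<open>Re (v\<^sup>* T)\<close>, and the flux replaces it by the product of the hat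
  variables minus \<open>|G|\<^sup>2 / Z\<close> (\<open>right_face_balance\<close>, \<open>left_face_balance\<close>). This holds because hat
  variables and traces share the characteristic variable that leaves the element, so that
  \<open>v\<close> and \<open>T\<close> differ from them by \<open>G / Z\<close> and \<open>\<plusminus> G\<close>. The result is the identity
  \<open>element_energy_balance\<close>.

  Adding the two elements, the interface products cancel, since the hat variables are
  continuous there; what remains of the surface terms is \<open>BT / 2\<close>, the weight being that of the
  discrete norm. The source term is bounded by the Cauchy-Schwarz inequality for the form
  \<open>H P\<^sup>-\<^sup>1\<close>, which is symmetric and positive semidefinite because it is a Kronecker product of
  \<open>P\<^sup>-\<^sup>1\<close> with a nonnegative diagonal matrix. Finally \<open>BT \<le> 0\<close>: at an external face the boundary
  condition makes the hat velocity zero or the hat traction a real multiple of it, of known sign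
  (\<open>reflecting_face_dissipative\<close>), and the remaining terms are negative squares.\<close>

section \<open>Hermitian forms of real matrices\<close>

definition cdot :: "complex ^ 'n::finite \<Rightarrow> complex ^ 'n \<Rightarrow> complex" where
  "cdot x y = (\<Sum>i\<in>UNIV. cnj (x $ i) * y $ i)"

lemma cdot_add_right: "cdot x (y + z) = cdot x y + cdot x z"
  by (simp add: cdot_def distrib_left sum.distrib)

lemma cdot_diff_right: "cdot x (y - z) = cdot x y - cdot x z"
  by (simp add: cdot_def right_diff_distrib sum_subtractf)

lemma cdot_uminus_right: "cdot x (- y) = - cdot x y"
  by (simp add: cdot_def sum_negf)

lemma cdot_scale_right: "cdot x (c *s y) = c * cdot x y"
  by (simp add: cdot_def sum_distrib_left mult_ac)

lemma cdot_scale_left: "cdot (c *s x) y = cnj c * cdot x y"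
  by (simp add: cdot_def sum_distrib_left mult_ac)

lemma cnj_cdot: "cnj (cdot x y) = cdot y x"
  by (simp add: cdot_def mult.commute)

lemma cmat_mult: "cmat (A ** B) = cmat A ** cmat B"
  by (simp add: cmat_def matrix_matrix_mult_def vec_eq_iff)

lemma cmat_add: "cmat (A + B) = cmat A + cmat B"
  by (simp add: cmat_def vec_eq_iff)

lemma cmat_diff: "cmat (A - B) = cmat A - cmat B"
  by (simp add: cmat_def vec_eq_iff)

lemma cmat_scaleR_mult_vec: "cmat (c *\<^sub>R A) *v x = of_real c *s (cmat A *v x)"
  by (simp add: cmat_def vec_eq_iff matrix_vector_mult_def sum_distrib_left mult_ac)

lemma cmat_transpose: "transpose (cmat A) = cmat (transpose A)"
  by (simp add: cmat_def transpose_def vec_eq_iff)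

lemma matrix_mult_vec_scale: "(A :: complex ^ 'm ^ 'k) *v (c *s x) = c *s (A *v x)"
  by (simp add: vec_eq_iff matrix_vector_mult_def sum_distrib_left mult_ac)

lemma matrix_mult_diff_right: "(A :: real ^ 'm ^ 'k) ** (B - C) = A ** B - A ** C"
  by (simp add: matrix_matrix_mult_def vec_eq_iff right_diff_distrib sum_subtractf)

text \<open>Moves operators between the two arguments; since the matrices are real, only a transpose appears.\<close>

lemma cdot_cmat_adjoint: "cdot x (cmat A *v y) = cdot (cmat (transpose A) *v x) y"
proof -
  have "cdot x (cmat A *v y) = (\<Sum>i\<in>UNIV. \<Sum>j\<in>UNIV. cnj (x $ i) * (of_real (A $ i $ j) * y $ j))"
    by (simp add: cdot_def cmat_def matrix_vector_mult_def sum_distrib_left)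
  also have "\<dots> = (\<Sum>j\<in>UNIV. \<Sum>i\<in>UNIV. cnj (x $ i) * (of_real (A $ i $ j) * y $ j))"
    by (rule sum.swap)
  also have "\<dots> = cdot (cmat (transpose A) *v x) y"
    unfolding cdot_def matrix_vector_mult_def
    by (simp add: cmat_def sum_distrib_left sum_distrib_right transpose_def mult_ac)
  finally show ?thesis .
qed

text \<open>The forms of \<open>M\<close> and of its transpose are complex conjugates of each other.\<close>

lemma Re_cdot_skew_part: "Re (cdot x (cmat (M - transpose M) *v x)) = 0"
proof -
  have "cdot x (cmat (transpose M) *v x) = cnj (cdot x (cmat M *v x))"
    unfolding cnj_cdot by (subst cdot_cmat_adjoint) (simp only: transpose_transpose)
  then show ?thesis
    by (simp add: cmat_diff matrix_vector_mult_diff_rdistrib cdot_diff_right del: transpose_matrix_vector)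
qed

definition pos_semidef :: "real ^ 'n ^ 'n \<Rightarrow> bool" where
  "pos_semidef V \<longleftrightarrow> transpose V = V \<and> (\<forall>x. 0 \<le> x \<bullet> (V *v x))"

text \<open>The real part of a real form is the sum of its values on the real and on the imaginary parts of
  the arguments, so that positivity over the reals carries over to complex vectors.\<close>

lemma Re_cdot_cmat:
  "Re (cdot x (cmat V *v y)) =
     (\<chi> i. Re (x $ i)) \<bullet> (V *v (\<chi> i. Re (y $ i))) + (\<chi> i. Im (x $ i)) \<bullet> (V *v (\<chi> i. Im (y $ i)))"
  by (simp add: cdot_def cmat_def matrix_vector_mult_def inner_vec_def sum.distrib)

lemma cdot_pos_semidef:
  assumes "pos_semidef V"
  shows "Im (cdot x (cmat V *v x)) = 0" and "0 \<le> Re (cdot x (cmat V *v x))"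
proof -
  have "cnj (cdot x (cmat V *v x)) = cdot x (cmat V *v x)"
    using assms by (subst (2) cdot_cmat_adjoint) (simp add: cnj_cdot pos_semidef_def)
  then show "Im (cdot x (cmat V *v x)) = 0"
    by (simp add: complex_eq_iff)
  show "0 \<le> Re (cdot x (cmat V *v x))"
    using assms by (simp add: Re_cdot_cmat pos_semidef_def)
qed

text \<open>The discriminant argument behind the Cauchy-Schwarz inequality. A vanishing \<open>C\<close> is admitted, so
  that it applies to semidefinite forms.\<close>

lemma quadratic_nonneg_imp_le_sqrt:
  fixes A B C :: real
  assumes "\<And>t. 0 \<le> A - 2 * t * B + t\<^sup>2 * C"
  shows "B \<le> sqrt A * sqrt C"
proof (cases "C = 0")
  case True
  have "B = 0"
  proof (rule ccontr)
    assume "B \<noteq> 0"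
    then show False
      using assms[of "(A + 1) / (2 * B)"] True by simp
  qed
  then show ?thesis using True by simp
next
  case False
  have A: "0 \<le> A" using assms[of 0] by simp
  \<comment> \<open>The value of the quadratic at its minimum.\<close>
  have *: "C * (A - 2 * (B / C) * B + (B / C)\<^sup>2 * C) = A * C - B\<^sup>2"
    using False by (simp add: field_simps power2_eq_square)
  have C: "C > 0"
  proof (rule ccontr)
    assume "\<not> C > 0"
    then have "C < 0" using False by simp
    \<comment> \<open>This makes \<open>t\<^sup>2 C = - (A + 1)\<close>; the values at \<open>t\<close> and \<open>- t\<close> then add up to \<open>- 2\<close>.\<close>
    define t where "t = sqrt ((A + 1) / (- C))"
    have "(A + 1) / (- C) \<ge> 0" using A \<open>C < 0\<close> by (simp add: divide_nonneg_neg)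
    then have "t\<^sup>2 * C = - (A + 1)" using \<open>C < 0\<close> by (simp add: t_def)
    then show False using assms[of t] assms[of "- t"] by simp
  qed
  have "0 \<le> A * C - B\<^sup>2"
    unfolding *[symmetric] using C assms[of "B / C"] by simp
  then have "B \<le> sqrt (A * C)" by (intro real_le_rsqrt) simp
  then show ?thesis by (simp add: real_sqrt_mult)
qed

lemma cdot_Cauchy_Schwarz:
  assumes V: "pos_semidef V"
  shows "Re (cdot x (cmat V *v y)) \<le> sqrt (Re (cdot x (cmat V *v x))) * sqrt (Re (cdot y (cmat V *v y)))"
proof (rule quadratic_nonneg_imp_le_sqrt)
  fix t :: real
  let ?b = "\<lambda>u w. cdot u (cmat V *v w)"
  have sym: "?b y x = cnj (?b x y)"
    using V by (subst cdot_cmat_adjoint) (simp add: cnj_cdot pos_semidef_def)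
  let ?z = "x - of_real t *s y"
  have left: "cdot ?z w = cdot x w - of_real t * cdot y w" for w
    by (simp add: cdot_def algebra_simps sum_subtractf sum_distrib_left)
  have "?b ?z ?z = ?b x x - of_real t * ?b x y - of_real t * (?b y x - of_real t * ?b y y)"
    by (simp only: left matrix_vector_mult_diff_distrib matrix_mult_vec_scale cdot_diff_right
        cdot_scale_right)
      (simp add: algebra_simps)
  then have "Re (?b ?z ?z) = Re (?b x x) - t * Re (?b x y) - t * (Re (?b x y) - t * Re (?b y y))"
    by (simp only: sym) simp
  then have "Re (?b ?z ?z) = Re (?b x x) - 2 * t * Re (?b x y) + t\<^sup>2 * Re (?b y y)"
    by (simp only: power2_eq_square) (simp only: algebra_simps)
  then show "0 \<le> Re (?b x x) - 2 * t * Re (?b x y) + t\<^sup>2 * Re (?b y y)"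
    using cdot_pos_semidef(2)[OF V, of ?z] by simp
qed

section \<open>Kronecker products and diagonal matrices\<close>

lemma sum_UNIV_prod: "(\<Sum>k\<in>UNIV. f k) = (\<Sum>a\<in>UNIV. \<Sum>b\<in>UNIV. f (a, b))"
  by (simp add: sum.cartesian_product)

text \<open>The mixed product rule. All commutation relations between the element operators are instances of
  it: both sides reduce to the same Kronecker product, slot by slot.\<close>

lemma kron_mult:
  fixes A :: "'a::comm_semiring_1 ^ 'm::finite ^ 'k" and B :: "'a ^ 'q::finite ^ 'p"
  shows "(A \<otimes> B) ** (C \<otimes> D) = (A ** C) \<otimes> (B ** D)"
  by (simp add: kron_def matrix_matrix_mult_def vec_eq_iff sum_UNIV_prod sum_product mult_ac)

lemma transpose_kron: "transpose (A \<otimes> B) = transpose A \<otimes> transpose B"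
  by (simp add: kron_def transpose_def vec_eq_iff)

lemma mat_one_eq_diag: "mat 1 = diag (\<lambda>_. 1)"
  by (simp add: mat_def diag_def)

lemma diag_kron_diag: "diag a \<otimes> diag b = diag (\<lambda>(i, j). (a i :: real) * b j)"
  by (auto simp: diag_def kron_def vec_eq_iff)

lemma mat_kron_mat: "(mat 1 :: real ^ 'n ^ 'n) \<otimes> (mat 1 :: real ^ 'm ^ 'm) = mat 1"
  by (auto simp: mat_def kron_def vec_eq_iff)

lemma transpose_diag: "transpose (diag a) = diag a"
  by (auto simp: diag_def transpose_def vec_eq_iff)

lemma diag_mult_diag: "diag a ** diag b = diag (\<lambda>i. (a i :: real) * b i)"
  by (simp add: diag_def matrix_matrix_mult_def vec_eq_iff if_distrib[of "\<lambda>x. x * _"]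
      if_distrib[of "\<lambda>x. _ * x"] cong: if_cong)

lemma cmat_diag_mult_vec: "(cmat (diag a) *v x) $ i = of_real (a i) * x $ i"
proof -
  have "(cmat (diag a) *v x) $ i = (\<Sum>j\<in>UNIV. if j = i then of_real (a i) * x $ j else 0)"
    unfolding matrix_vector_mult_def cmat_def diag_def vec_lambda_beta
    by (intro sum.cong refl) auto
  then show ?thesis by simp
qed

text \<open>An operator on the fields acts separately at each node.\<close>

lemma cmat_kron_mat_mult_vec:
  fixes A :: "real ^ 'm::finite ^ 'k" and x :: "complex ^ ('m \<times> 'n::finite)"
  shows "(cmat (A \<otimes> mat 1) *v x) $ (f, n) = (cmat A *v (\<chi> g. x $ (g, n))) $ f"
proof -
  have "(cmat (A \<otimes> mat 1) *v x) $ (f, n) =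
      (\<Sum>g\<in>UNIV. \<Sum>m\<in>UNIV. if m = n then of_real (A $ f $ g) * x $ (g, m) else 0)"
    unfolding matrix_vector_mult_def cmat_def kron_def mat_def vec_lambda_beta sum_UNIV_prod
    by (intro sum.cong refl) auto
  then show ?thesis
    by (simp add: matrix_vector_mult_def cmat_def)
qed

text \<open>The form is the sum, over the nodes \<open>n\<close>, of \<open>w n\<close> times the form of \<open>A\<close> on the field values
  at \<open>n\<close>.\<close>

lemma pos_semidef_kron_diag:
  fixes A :: "real ^ 'm::finite ^ 'm" and w :: "'n::finite \<Rightarrow> real"
  assumes A: "pos_semidef A" and w: "\<And>n. 0 \<le> w n"
  shows "pos_semidef (A \<otimes> diag w)"
  unfolding pos_semidef_def
proof (intro conjI allI)
  show "transpose (A \<otimes> diag w) = A \<otimes> diag w"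
    using A by (simp add: transpose_kron transpose_diag pos_semidef_def)
  fix x :: "real ^ ('m \<times> 'n)"
  define sl where "sl n = (\<chi> f. x $ (f, n))" for n
  have entry: "((A \<otimes> diag w) *v x) $ (f, n) = w n * (A *v sl n) $ f" for f n
  proof -
    have "((A \<otimes> diag w) *v x) $ (f, n) =
        (\<Sum>g\<in>UNIV. \<Sum>m\<in>UNIV. if m = n then A $ f $ g * w n * x $ (g, m) else 0)"
      unfolding matrix_vector_mult_def kron_def diag_def vec_lambda_beta sum_UNIV_prod
      by (intro sum.cong refl) auto
    then show ?thesis
      by (simp add: matrix_vector_mult_def sl_def sum_distrib_left mult_ac)
  qed
  have "x \<bullet> ((A \<otimes> diag w) *v x) = (\<Sum>f\<in>UNIV. \<Sum>n\<in>UNIV. x $ (f, n) * (w n * (A *v sl n) $ f))"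
    by (simp add: inner_vec_def sum_UNIV_prod entry)
  also have "\<dots> = (\<Sum>n\<in>UNIV. \<Sum>f\<in>UNIV. x $ (f, n) * (w n * (A *v sl n) $ f))"
    by (rule sum.swap)
  also have "\<dots> = (\<Sum>n\<in>UNIV. w n * (sl n \<bullet> (A *v sl n)))"
    by (simp add: inner_vec_def sl_def sum_distrib_left mult_ac)
  also have "\<dots> \<ge> 0"
    using A w by (intro sum_nonneg mult_nonneg_nonneg) (auto simp: pos_semidef_def)
  finally show "0 \<le> x \<bullet> ((A \<otimes> diag w) *v x)" .
qed

lemma matrix_inv_eqI:
  fixes A :: "real ^ 'n ^ 'n"
  assumes "A ** B = mat 1"
  shows "matrix_inv A = B"
proof -
  have "B ** A = mat 1" using assms matrix_left_right_inverse by blast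
  then have "invertible A" using assms invertible_def by blast
  then have "matrix_inv A ** A = mat 1"
    using someI_ex[of "\<lambda>A'. A ** A' = mat 1 \<and> A' ** A = mat 1"]
    unfolding invertible_def matrix_inv_def by blast
  then show ?thesis
    by (metis assms matrix_mul_assoc matrix_mul_lid matrix_mul_rid)
qed

text \<open>With \<open>x = A y\<close> the form of the inverse at \<open>x\<close> is the form of \<open>A\<close> at \<open>y\<close>.\<close>

lemma sym_pos_def_inverse:
  fixes A :: "real ^ 'n ^ 'n"
  assumes A: "sym_pos_def A"
  shows "A ** matrix_inv A = mat 1" and "pos_semidef (matrix_inv A)"
proof -
  have "\<forall>x. A *v x = 0 \<longrightarrow> x = 0"
    using A unfolding sym_pos_def_def by force
  then obtain B where BA: "B ** A = mat 1"
    using matrix_left_invertible_ker by blast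
  then have AB: "A ** B = mat 1"
    using matrix_left_right_inverse by blast
  have inv: "matrix_inv A = B" using AB by (rule matrix_inv_eqI)
  show "A ** matrix_inv A = mat 1" using AB inv by simp
  have sym: "transpose B = B"
  proof -
    have "A ** transpose B = mat 1"
      using BA A by (metis matrix_transpose_mul transpose_mat sym_pos_def_def)
    then have "matrix_inv A = transpose B" by (rule matrix_inv_eqI)
    then show ?thesis using inv by simp
  qed
  have "0 \<le> x \<bullet> (B *v x)" for x
  proof -
    have x: "x = A *v (B *v x)" by (simp add: matrix_vector_mul_assoc AB)
    have "x \<bullet> (B *v x) = (B *v x) \<bullet> (A *v (B *v x))"
      by (subst (1) x) (rule inner_commute)
    also have "\<dots> \<ge> 0"
      using A unfolding sym_pos_def_def by (cases "B *v x = 0") (auto intro: less_imp_le)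
    finally show ?thesis .
  qed
  then show "pos_semidef (matrix_inv A)"
    using sym inv by (simp add: pos_semidef_def)
qed

section \<open>Element operators\<close>

lemma H1_inverse:
  assumes "\<And>i. h i > 0"
  shows "H1 h ** diag (\<lambda>i. 1 / h i) = mat 1"
  using assms by (simp add: H1_def diag_mult_diag mat_one_eq_diag less_imp_neq[THEN not_sym])

lemma Hx_inverse:
  assumes "\<And>i. h i > 0" and "\<Delta>x > 0"
  shows "Hx \<Delta>x h ** matrix_inv (Hx \<Delta>x h) = mat 1"
proof -
  have inv: "Hx \<Delta>x h ** ((2 / \<Delta>x) *\<^sub>R (mat 1 \<otimes> diag (\<lambda>i. 1 / h i) \<otimes> mat 1 \<otimes> mat 1)) = mat 1"
    using assms
    by (simp add: Hx_def kron_mult H1_inverse scalar_matrix_assoc[symmetric] matrix_scalar_ac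
        mat_kron_mat)
  show ?thesis
    unfolding matrix_inv_eqI[OF inv] by (rule inv)
qed

text \<open>What remains of the full quadrature matrix \<open>Hxyz\<close> once the factor \<open>Hx\<close> is cancelled: the
  quadrature on the slices orthogonal to the x-direction.\<close>

definition Wyz :: "real \<Rightarrow> real \<Rightarrow> ('n::finite \<Rightarrow> real) \<Rightarrow> real ^ 'n dof ^ 'n dof" where
  "Wyz \<Delta>y \<Delta>z h = (\<Delta>y / 2 * (\<Delta>z / 2)) *\<^sub>R (mat 1 \<otimes> mat 1 \<otimes> H1 h \<otimes> H1 h)"

text \<open>\<open>Wface\<close> and \<open>Aface\<close> are the counterparts of \<open>Wyz\<close> and \<open>Ax\<close> on face vectors, in which the x-slot
  has a single node.\<close>

definition Wface :: "real \<Rightarrow> real \<Rightarrow> ('n::finite \<Rightarrow> real) \<Rightarrow> real ^ 'n face_dof ^ 'n face_dof" where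
  "Wface \<Delta>y \<Delta>z h = (\<Delta>y / 2 * (\<Delta>z / 2)) *\<^sub>R (mat 1 \<otimes> mat 1 \<otimes> H1 h \<otimes> H1 h)"

definition Aface :: "real ^ 'n::finite face_dof ^ 'n face_dof" where
  "Aface = A9 \<otimes> mat 1 \<otimes> mat 1 \<otimes> mat 1"

lemmas kron_simps = kron_mult scalar_matrix_assoc[symmetric] matrix_scalar_ac transpose_kron

lemma Hxyz_eq:
  "Hxyz \<Delta>x \<Delta>y \<Delta>z h =
     (\<Delta>x / 2 * (\<Delta>y / 2) * (\<Delta>z / 2)) *\<^sub>R (mat 1 \<otimes> H1 h \<otimes> H1 h \<otimes> H1 h)"
  by (simp add: Hxyz_def Hx_def Hy_def Hz_def kron_simps mult_ac)

lemma Hxyz_mult_inv_Hx: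
  assumes "\<And>i. h i > 0" and "\<Delta>x > 0"
  shows "Hxyz \<Delta>x \<Delta>y \<Delta>z h ** matrix_inv (Hx \<Delta>x h) = Wyz \<Delta>y \<Delta>z h"
proof -
  have "Hxyz \<Delta>x \<Delta>y \<Delta>z h = Wyz \<Delta>y \<Delta>z h ** Hx \<Delta>x h"
    by (simp add: Hxyz_eq Wyz_def Hx_def kron_simps mult_ac)
  then show ?thesis
    using Hx_inverse[of h \<Delta>x] assms by (simp add: matrix_mul_assoc[symmetric])
qed

lemma transpose_A9: "transpose A9 = A9"
  by (auto simp: A9_def block_mat_def transpose_def vec_eq_iff split: sum.splits)

text \<open>Cancelling \<open>Hx\<close> and sorting the Kronecker factors turns the second derivative term into the
  transpose of the first.\<close>

lemma volume_term_skew: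
  fixes q h :: "'n::finite \<Rightarrow> real" and \<Delta>x \<Delta>y \<Delta>z :: real
  assumes "\<And>i. h i > 0" and "\<Delta>x > 0"
  defines "M \<equiv> Hxyz \<Delta>x \<Delta>y \<Delta>z h ** (Ax ** Dx \<Delta>x q h)"
  shows "Hxyz \<Delta>x \<Delta>y \<Delta>z h **
      (Ax ** Dx \<Delta>x q h - matrix_inv (Hx \<Delta>x h) ** Ax ** transpose (Dx \<Delta>x q h) ** Hx \<Delta>x h)
    = M - transpose M"
proof -
  have "Hxyz \<Delta>x \<Delta>y \<Delta>z h ** (matrix_inv (Hx \<Delta>x h) ** Ax ** transpose (Dx \<Delta>x q h) ** Hx \<Delta>x h)
      = Wyz \<Delta>y \<Delta>z h ** Ax ** transpose (Dx \<Delta>x q h) ** Hx \<Delta>x h"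
    by (simp add: matrix_mul_assoc Hxyz_mult_inv_Hx assms)
  also have "\<dots> = transpose M"
    by (simp add: M_def Hxyz_eq Wyz_def Ax_def Dx_def Hx_def kron_simps transpose_scalar
        transpose_A9 matrix_transpose_mul transpose_diag H1_def mult_ac)
  finally show ?thesis
    by (simp add: matrix_mult_diff_right M_def)
qed

text \<open>\<open>Wyz\<close> and \<open>Ax\<close> act trivially in the x-slot and \<open>ex\<close> only there, so they commute up to the change
  from element to face vectors.\<close>

lemma Wyz_mult_ex: "Wyz \<Delta>y \<Delta>z h ** ex q \<psi> = ex q \<psi> ** Wface \<Delta>y \<Delta>z h"
  by (simp add: Wyz_def Wface_def ex_def kron_simps)

lemma Ax_mult_ex: "Ax ** ex q \<psi> = ex q \<psi> ** Aface"
  by (simp add: Ax_def Aface_def ex_def kron_simps)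

text \<open>Extension from a face is adjoint to the trace on it.\<close>

lemma cdot_ex: "cdot Q (cmat (ex q \<psi>) *v y) = cdot (trace_x q \<psi> Q) y"
  by (simp only: cdot_cmat_adjoint trace_x_def cmat_transpose)

lemma Wyz_trace:
  "cdot Q (cmat (Wyz \<Delta>y \<Delta>z h) *v (cmat (ex q \<psi>) *v y))
     = cdot (trace_x q \<psi> Q) (cmat (Wface \<Delta>y \<Delta>z h) *v y)"
  by (simp only: matrix_vector_mul_assoc cmat_mult[symmetric] Wyz_mult_ex)
    (simp only: cmat_mult matrix_vector_mul_assoc[symmetric] cdot_ex)

lemma Wyz_Ax_Bx:
  "cdot Q (cmat (Wyz \<Delta>y \<Delta>z h ** Ax ** Bx q \<psi>) *v Q)
     = cdot (trace_x q \<psi> Q) (cmat (Wface \<Delta>y \<Delta>z h) *v (cmat Aface *v trace_x q \<psi> Q))"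
proof -
  have "Wyz \<Delta>y \<Delta>z h ** Ax ** Bx q \<psi>
      = Wyz \<Delta>y \<Delta>z h ** (ex q \<psi> ** (Aface ** transpose (ex q \<psi>)))"
    by (simp only: Bx_def matrix_mul_assoc Ax_mult_ex[symmetric])
  then show ?thesis
    by (simp only: cmat_mult matrix_vector_mul_assoc[symmetric] Wyz_trace)
      (simp only: trace_x_def cmat_transpose)
qed

section \<open>Faces\<close>

text \<open>The nine field values at one node of a face.\<close>

definition node :: "complex ^ 'n::finite face_dof \<Rightarrow> 'n \<Rightarrow> 'n \<Rightarrow> complex ^ (axis + stress)" where
  "node t i k = (\<chi> f. t $ (f, 1, i, k))"

lemma cdot_Wface:
  "cdot t (cmat (Wface \<Delta>y \<Delta>z h) *v y) =
     of_real (\<Delta>y / 2 * (\<Delta>z / 2)) *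
       (\<Sum>i\<in>UNIV. \<Sum>k\<in>UNIV. cdot (node t i k) (node y i k) * of_real (h i * h k))"
proof -
  let ?c = "complex_of_real (\<Delta>y / 2 * (\<Delta>z / 2))"
  have "cdot t (cmat (Wface \<Delta>y \<Delta>z h) *v y)
      = ?c * (\<Sum>f\<in>UNIV. \<Sum>i\<in>UNIV. \<Sum>k\<in>UNIV.
          cnj (t $ (f, 1, i, k)) * (of_real (h i * h k) * y $ (f, 1, i, k)))"
    unfolding Wface_def cmat_scaleR_mult_vec cdot_scale_right
    by (rule arg_cong[where f = "(*) ?c"])
      (simp add: mat_one_eq_diag H1_def diag_kron_diag cdot_def cmat_diag_mult_vec sum_UNIV_prod
        UNIV_1)
  also have "(\<Sum>f\<in>UNIV. \<Sum>i\<in>UNIV. \<Sum>k\<in>UNIV.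
        cnj (t $ (f, 1, i, k)) * (of_real (h i * h k) * y $ (f, 1, i, k)))
      = (\<Sum>i\<in>UNIV. \<Sum>f\<in>UNIV. \<Sum>k\<in>UNIV.
        cnj (t $ (f, 1, i, k)) * (of_real (h i * h k) * y $ (f, 1, i, k)))"
    by (rule sum.swap)
  also have "\<dots> = (\<Sum>i\<in>UNIV. \<Sum>k\<in>UNIV. \<Sum>f\<in>UNIV.
        cnj (t $ (f, 1, i, k)) * (of_real (h i * h k) * y $ (f, 1, i, k)))"
    by (intro sum.cong refl sum.swap)
  also have "\<dots> = (\<Sum>i\<in>UNIV. \<Sum>k\<in>UNIV. cdot (node t i k) (node y i k) * of_real (h i * h k))"
    by (simp add: cdot_def node_def sum_distrib_left sum_distrib_right mult_ac)
  finally show ?thesis .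
qed

lemma node_Aface: "node (cmat Aface *v t) i k = cmat A9 *v node t i k"
  by (simp add: vec_eq_iff node_def Aface_def mat_kron_mat cmat_kron_mat_mult_vec)

lemma sum_UNIV_Plus: "(\<Sum>f\<in>UNIV. g f) = (\<Sum>a\<in>UNIV. g (Inl a)) + (\<Sum>b\<in>UNIV. g (Inr b))"
  for g :: "'a::finite + 'b::finite \<Rightarrow> 'c::comm_monoid_add"
  by (simp add: sum.Plus flip: UNIV_Plus_UNIV)

lemma cdot_block_vec: "cdot (block_vec v w) (block_vec v' w') = cdot v v' + cdot w w'"
  by (simp add: cdot_def block_vec_def sum_UNIV_Plus)

lemma A9_block_vec:
  "cmat A9 *v block_vec v w = block_vec (cmat a_x *v w) (cmat (transpose a_x) *v v)"
  by (simp add: vec_eq_iff A9_def block_vec_def block_mat_def cmat_def matrix_vector_mult_def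
      sum_UNIV_Plus split: sum.split)

lemma node_trace:
  "node (trace_x q \<psi> Q) i k =
     block_vec (vel q \<psi> Q i k) (\<chi> m. trace_x q \<psi> Q $ (Inr m, 1, i, k))"
  by (simp add: vec_eq_iff node_def block_vec_def vel_def split: sum.split)

text \<open>\<open>A\<^sub>x\<close> couples velocities and stresses through the traction only.\<close>

lemma trace_A9_trace:
  "cdot (node (trace_x q \<psi> Q) i k) (cmat A9 *v node (trace_x q \<psi> Q) i k)
     = cdot (vel q \<psi> Q i k) (trac q \<psi> Q i k) + cdot (trac q \<psi> Q i k) (vel q \<psi> Q i k)"
  by (simp only: node_trace A9_block_vec cdot_block_vec cdot_cmat_adjoint[of _ "transpose a_x"]
      transpose_transpose trac_def)

text \<open>The flux in the stress equations is \<open>a\<^sub>x\<^sup>T\<close> of something, so it is tested against the traction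
  \<open>a\<^sub>x \<sigma>\<close> alone.\<close>

lemma trace_stress_flux:
  assumes "\<And>\<eta>. impedance M \<eta> \<noteq> 0"
  shows "cdot (\<chi> m. trace_x q \<psi> Q $ (Inr m, 1, i, k))
      (cmat (transpose a_x ** matrix_inv (Zmat M)) *v g)
    = (\<Sum>\<eta>\<in>UNIV. cnj (trac q \<psi> Q i k $ \<eta>) * g $ \<eta> / of_real (impedance M \<eta>))"
proof -
  have "matrix_inv (Zmat M) = diag (\<lambda>\<eta>. 1 / impedance M \<eta>)"
    using assms by (intro matrix_inv_eqI) (simp add: Zmat_def diag_mult_diag mat_one_eq_diag)
  then have "cdot (\<chi> m. trace_x q \<psi> Q $ (Inr m, 1, i, k))
        (cmat (transpose a_x ** matrix_inv (Zmat M)) *v g)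
      = cdot (trac q \<psi> Q i k) (cmat (diag (\<lambda>\<eta>. 1 / impedance M \<eta>)) *v g)"
    by (simp only: cmat_mult matrix_vector_mul_assoc[symmetric]
        cdot_cmat_adjoint[of _ "transpose a_x"] transpose_transpose trac_def)
  then show ?thesis
    by (simp add: cdot_def cmat_diag_mult_vec)
qed

lemma trace_FR:
  assumes "\<And>\<eta>. impedance M \<eta> \<noteq> 0"
  shows "cdot (node (trace_x q \<psi> Q) i k) (node (FR M G) i k)
    = (\<Sum>\<eta>\<in>UNIV. cnj (vel q \<psi> Q i k $ \<eta>) * G i k $ \<eta>
        + cnj (trac q \<psi> Q i k $ \<eta>) * G i k $ \<eta> / of_real (impedance M \<eta>))"
proof -
  have "node (FR M G) i k = block_vec (G i k) (cmat (transpose a_x ** matrix_inv (Zmat M)) *v G i k)"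
    by (simp add: vec_eq_iff node_def FR_def)
  then show ?thesis
    by (simp only: node_trace cdot_block_vec trace_stress_flux[OF assms] sum.distrib)
      (simp only: cdot_def)
qed

lemma trace_FL:
  assumes "\<And>\<eta>. impedance M \<eta> \<noteq> 0"
  shows "cdot (node (trace_x q \<psi> Q) i k) (node (FL M G) i k)
    = (\<Sum>\<eta>\<in>UNIV. cnj (vel q \<psi> Q i k $ \<eta>) * G i k $ \<eta>
        - cnj (trac q \<psi> Q i k $ \<eta>) * G i k $ \<eta> / of_real (impedance M \<eta>))"
proof -
  have "node (FL M G) i k = block_vec (G i k) (- (cmat (transpose a_x ** matrix_inv (Zmat M)) *v G i k))"
    by (simp add: vec_eq_iff node_def FL_def)
  then show ?thesis
    by (simp only: node_trace cdot_block_vec cdot_uminus_right trace_stress_flux[OF assms] sum_subtractf)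
      (simp only: cdot_def add_uminus_conv_diff)
qed

section \<open>The discrete norm\<close>

lemma sym_pos_def_P9:
  assumes "valid_medium M"
  shows "sym_pos_def (P9 M)"
  unfolding sym_pos_def_def
proof (intro conjI allI impI)
  have C: "transpose (stiff M) = stiff M"
    and Cpos: "\<And>w. w \<noteq> 0 \<Longrightarrow> w \<bullet> (stiff M *v w) > 0" and rho: "dens M > 0"
    using assms by (auto simp: valid_medium_def sym_pos_def_def)
  have "stiff M $ i $ j = stiff M $ j $ i" for i j
    using arg_cong[OF C, of "\<lambda>A. A $ j $ i"] by (simp add: transpose_def)
  then show "transpose (P9 M) = P9 M"
    by (auto simp: vec_eq_iff transpose_def P9_def block_mat_def mat_def split: sum.split)
  fix x :: "real ^ (axis + stress)"
  assume x: "x \<noteq> 0"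
  define v w where "v = (\<chi> a. x $ Inl a)" and "w = (\<chi> b. x $ Inr b)"
  have mat: "(\<Sum>j\<in>UNIV. (mat c :: real ^ axis ^ axis) $ i $ j * y $ j) = c * y $ i" for c i and y :: "real ^ axis"
  proof -
    have "(\<Sum>j\<in>UNIV. (mat c :: real ^ axis ^ axis) $ i $ j * y $ j) = (\<Sum>j\<in>UNIV. if j = i then c * y $ j else 0)"
      by (intro sum.cong) (auto simp: mat_def)
    then show ?thesis by simp
  qed
  have form: "x \<bullet> (P9 M *v x) = inverse (dens M) * (v \<bullet> v) + w \<bullet> (stiff M *v w)"
    using mat[of "inverse (dens M)" _ v]
    by (simp add: inner_vec_def sum_UNIV_Plus matrix_vector_mult_def P9_def block_mat_def
        v_def w_def sum_distrib_left mult_ac)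
  show "x \<bullet> (P9 M *v x) > 0"
  proof (cases "w = 0")
    case True
    have "v \<noteq> 0"
    proof
      assume "v = 0"
      then have "x $ f = 0" for f
        using True by (cases f) (auto simp: v_def w_def vec_eq_iff)
      then show False using x by (simp add: vec_eq_iff)
    qed
    then show ?thesis using True rho by (simp add: form)
  next
    case False
    then show ?thesis using rho Cpos by (simp add: form add_nonneg_pos)
  qed
qed

lemma pos_semidef_scaleR:
  assumes "pos_semidef A" and "0 \<le> c"
  shows "pos_semidef (c *\<^sub>R A)"
  using assms by (simp add: pos_semidef_def transpose_scalar scaleR_matrix_vector_assoc[symmetric])

text \<open>The material matrix acts on the fields and the quadrature on the nodes, so the two commute and
  their product is a Kronecker product of a positive and a positive diagonal matrix.\<close>

lemma pos_semidef_energy_matrix: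
  assumes "\<And>i. h i > 0" and "\<Delta>x > 0" "\<Delta>y > 0" "\<Delta>z > 0" and M: "valid_medium M"
  shows "pos_semidef (Hxyz \<Delta>x \<Delta>y \<Delta>z h ** matrix_inv (Pmat M))"
proof -
  note P = sym_pos_def_inverse[OF sym_pos_def_P9[OF M]]
  have "matrix_inv (Pmat M :: real ^ 'a dof ^ 'a dof) = matrix_inv (P9 M) \<otimes> mat 1 \<otimes> mat 1 \<otimes> mat 1"
    by (intro matrix_inv_eqI) (simp add: Pmat_def kron_simps P(1) mat_kron_mat)
  then have "Hxyz \<Delta>x \<Delta>y \<Delta>z h ** matrix_inv (Pmat M)
      = (\<Delta>x / 2 * (\<Delta>y / 2) * (\<Delta>z / 2)) *\<^sub>R (matrix_inv (P9 M) \<otimes> H1 h \<otimes> H1 h \<otimes> H1 h)"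
    by (simp add: Hxyz_eq kron_simps)
  moreover have "pos_semidef (matrix_inv (P9 M) \<otimes> H1 h \<otimes> H1 h \<otimes> H1 h)"
    unfolding H1_def diag_kron_diag
    using assms by (intro pos_semidef_kron_diag P(2)) (auto intro: less_imp_le)
  ultimately show ?thesis
    using assms by (simp add: pos_semidef_scaleR)
qed

lemma hP_inner_eq_cdot:
  "hP_inner \<Delta>x \<Delta>y \<Delta>z h M Q F =
     1/2 * cdot Q (cmat (Hxyz \<Delta>x \<Delta>y \<Delta>z h ** matrix_inv (Pmat M)) *v F)"
  by (simp add: hP_inner_def cdot_def)

lemma hP_norm_Cauchy_Schwarz:
  assumes "\<And>i. h i > 0" and "\<Delta>x > 0" "\<Delta>y > 0" "\<Delta>z > 0" and "valid_medium M"
  shows "Re (hP_inner \<Delta>x \<Delta>y \<Delta>z h M Q F)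
    \<le> hP_norm \<Delta>x \<Delta>y \<Delta>z h M Q * hP_norm \<Delta>x \<Delta>y \<Delta>z h M F"
  using cdot_Cauchy_Schwarz[OF pos_semidef_energy_matrix[OF assms], where x = Q and y = F]
  by (simp add: hP_norm_def hP_inner_eq_cdot real_sqrt_divide)

text \<open>The weight \<open>r\<close> inside the norm comes out linearly, as a factor of the energy.\<close>

lemma hP_norm_scale_sqrt:
  assumes "\<And>i. h i > 0" and "\<Delta>x > 0" "\<Delta>y > 0" "\<Delta>z > 0" and "valid_medium M" and "r \<ge> 0"
  shows "(hP_norm \<Delta>x \<Delta>y \<Delta>z h M (of_real (sqrt r) *s Q))\<^sup>2 = r * Re (hP_inner \<Delta>x \<Delta>y \<Delta>z h M Q Q)"
proof -
  have "hP_inner \<Delta>x \<Delta>y \<Delta>z h M (of_real (sqrt r) *s Q) (of_real (sqrt r) *s Q)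
      = of_real (sqrt r * sqrt r) * hP_inner \<Delta>x \<Delta>y \<Delta>z h M Q Q"
    by (simp only: hP_inner_eq_cdot matrix_mult_vec_scale cdot_scale_left cdot_scale_right
        complex_cnj_complex_of_real of_real_mult) (simp only: mult_ac)
  then have "Re (hP_inner \<Delta>x \<Delta>y \<Delta>z h M (of_real (sqrt r) *s Q) (of_real (sqrt r) *s Q))
      = r * Re (hP_inner \<Delta>x \<Delta>y \<Delta>z h M Q Q)"
    using assms(6) by simp
  moreover have "0 \<le> Re (hP_inner \<Delta>x \<Delta>y \<Delta>z h M Q Q)"
    using cdot_pos_semidef(2)[OF pos_semidef_energy_matrix[OF assms(1-5)]]
    by (simp add: hP_inner_eq_cdot)
  ultimately show ?thesis
    using assms(6) by (simp add: hP_norm_def)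
qed

section \<open>Riemann problem at a face node\<close>

text \<open>By \<open>hat\<close>, the jumps \<open>v - vh\<close> and \<open>(T - Th) / \<zeta>\<close> agree; call them \<open>g\<close>. Then \<open>G = \<zeta> g\<close>, and inserting
  \<open>v = vh + g\<close>, \<open>T = Th + \<zeta> g\<close> cancels all mixed terms and leaves the square of \<open>G\<close>.\<close>

lemma right_face_balance:
  fixes v T vh Th G :: complex
  assumes z: "\<zeta> > 0" and hat: "of_real \<zeta> * vh - Th = of_real \<zeta> * v - T"
    and G: "G = 1/2 * of_real \<zeta> * (v - vh) + 1/2 * (T - Th)"
  shows "Re (cnj v * T) - Re (cnj v * G + cnj T * G / of_real \<zeta>)
    = Re (cnj Th * vh) - 1 / \<zeta> * (cmod G)\<^sup>2"
proof -
  define g where "g = v - vh"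
  have "T - Th = of_real \<zeta> * g"
    using hat by (simp add: g_def algebra_simps)
  then have T: "T = Th + of_real \<zeta> * g" and G': "G = of_real \<zeta> * g"
    by (simp_all add: G algebra_simps flip: g_def)
  have v: "v = vh + g" by (simp add: g_def)
  have "cnj T * G / of_real \<zeta> = cnj T * g" using z by (simp add: G')
  moreover have "1 / \<zeta> * (cmod G)\<^sup>2 = \<zeta> * ((Re g)\<^sup>2 + (Im g)\<^sup>2)"
    unfolding cmod_power2[symmetric] using z by (simp add: G' norm_mult power2_eq_square)
  ultimately show ?thesis
    by (simp add: T v G') (simp add: power2_eq_square algebra_simps)
qed

text \<open>The mirror image of the previous lemma: reflecting the x-axis changes the sign of the tractions.\<close>

lemma left_face_balance:
  fixes v T vh Th G :: complex
  assumes z: "\<zeta> > 0" and hat: "of_real \<zeta> * vh + Th = of_real \<zeta> * v + T"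
    and G: "G = 1/2 * of_real \<zeta> * (v - vh) - 1/2 * (T - Th)"
  shows "- Re (cnj v * T) - Re (cnj v * G - cnj T * G / of_real \<zeta>)
    = - Re (cnj Th * vh) - 1 / \<zeta> * (cmod G)\<^sup>2"
proof -
  have "of_real \<zeta> * vh - (- Th) = of_real \<zeta> * v - (- T)"
    and "G = 1/2 * of_real \<zeta> * (v - vh) + 1/2 * (- T - (- Th))"
    using hat G by (simp_all add: diff_divide_distrib)
  from right_face_balance[OF z this] show ?thesis by simp
qed

section \<open>Energy balance in one element\<close>

text \<open>The equation tested with \<open>Q\<^sup>\<dagger> H\<close>. The energy form is twice \<open>hP_inner\<close>, and everything except
  the volume term has moved to the faces.\<close>

lemma element_weak_form:
  fixes q h :: "'n::finite \<Rightarrow> real"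
  assumes h: "\<And>i. h i > 0" and \<Delta>: "\<Delta>x > 0"
    and eqn: "pml_equation \<Delta>x q h d \<alpha> s M Q GL GR F"
  shows "2 * ((s * pml_S d \<alpha> s) * hP_inner \<Delta>x \<Delta>y \<Delta>z h M Q Q)
    = 1/2 * (cdot Q (cmat (Hxyz \<Delta>x \<Delta>y \<Delta>z h **
          (Ax ** Dx \<Delta>x q h
            - matrix_inv (Hx \<Delta>x h) ** Ax ** transpose (Dx \<Delta>x q h) ** Hx \<Delta>x h)) *v Q)
        + (cdot (trace_x q 1 Q) (cmat (Wface \<Delta>y \<Delta>z h) *v (cmat Aface *v trace_x q 1 Q))
          - cdot (trace_x q (-1) Q) (cmat (Wface \<Delta>y \<Delta>z h) *v (cmat Aface *v trace_x q (-1) Q))))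
      - (cdot (trace_x q (-1) Q) (cmat (Wface \<Delta>y \<Delta>z h) *v FL M GL)
        + cdot (trace_x q 1 Q) (cmat (Wface \<Delta>y \<Delta>z h) *v FR M GR))
      + 2 * hP_inner \<Delta>x \<Delta>y \<Delta>z h M Q F"
proof -
  let ?H = "Hxyz \<Delta>x \<Delta>y \<Delta>z h" and ?W = "Wyz \<Delta>y \<Delta>z h" and ?Wf = "Wface \<Delta>y \<Delta>z h"
  let ?Hi = "matrix_inv (Hx \<Delta>x h)"
  let ?K = "Ax ** Dx \<Delta>x q h - ?Hi ** Ax ** transpose (Dx \<Delta>x q h) ** Hx \<Delta>x h"
  let ?t = "\<lambda>\<psi>. trace_x q \<psi> Q"
  let ?b = "\<lambda>\<psi>. cdot (?t \<psi>) (cmat ?Wf *v (cmat Aface *v ?t \<psi>))"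
  have HHi: "?H ** ?Hi = ?W" by (rule Hxyz_mult_inv_Hx[OF h \<Delta>])
  have "?H ** (?K + ?Hi ** Ax ** (Bx q 1 - Bx q (-1)))
      = ?H ** ?K + (?W ** Ax ** Bx q 1 - ?W ** Ax ** Bx q (-1))"
    by (simp only: matrix_add_ldistrib matrix_mul_assoc HHi) (simp only: matrix_mult_diff_right)
  moreover have "cdot Q (cmat ?H *v (cmat ((1/2) *\<^sub>R X) *v Q)) = 1/2 * cdot Q (cmat (?H ** X) *v Q)" for X
    by (simp add: cmat_scaleR_mult_vec matrix_mult_vec_scale cdot_scale_right cmat_mult
        matrix_vector_mul_assoc)
  ultimately have vol: "cdot Q (cmat ?H *v (cmat ((1/2) *\<^sub>R (?K + ?Hi ** Ax ** (Bx q 1 - Bx q (-1)))) *v Q))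
      = 1/2 * (cdot Q (cmat (?H ** ?K) *v Q) + (?b 1 - ?b (-1)))"
    by (simp only: cmat_add cmat_diff matrix_vector_mult_add_rdistrib
        matrix_vector_mult_diff_rdistrib cdot_add_right cdot_diff_right Wyz_Ax_Bx)
  have surf: "cdot Q (cmat ?H *v (cmat ?Hi *v (cmat (ex q \<psi>) *v y)))
      = cdot (?t \<psi>) (cmat ?Wf *v y)" for \<psi> y
    by (simp only: matrix_vector_mul_assoc[of "cmat ?H"] cmat_mult[symmetric] HHi Wyz_trace)
  have energy: "cdot Q (cmat ?H *v (cmat (matrix_inv (Pmat M)) *v y))
      = 2 * hP_inner \<Delta>x \<Delta>y \<Delta>z h M Q y" for y
    by (simp add: hP_inner_eq_cdot matrix_vector_mul_assoc cmat_mult)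
  have scale: "hP_inner \<Delta>x \<Delta>y \<Delta>z h M Q (c *s Q) = c * hP_inner \<Delta>x \<Delta>y \<Delta>z h M Q Q" for c
    by (simp add: hP_inner_eq_cdot matrix_mult_vec_scale cdot_scale_right)
  show ?thesis
    using arg_cong[OF eqn[unfolded pml_equation_def], of "\<lambda>y. cdot Q (cmat ?H *v y)"]
    by (simp only: matrix_vector_right_distrib matrix_vector_mult_diff_distrib cdot_add_right
        cdot_diff_right vol surf energy scale)
qed

text \<open>The real parts of all face terms have this form; it is the real-valued version of \<open>face_sum\<close>, in
  which the balances at the single nodes are added up.\<close>

definition face_quad :: "real \<Rightarrow> real \<Rightarrow> ('n::finite \<Rightarrow> real) \<Rightarrow> ('n \<Rightarrow> 'n \<Rightarrow> axis \<Rightarrow> real) \<Rightarrow> real" where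
  "face_quad \<Delta>y \<Delta>z h p =
     \<Delta>y / 2 * (\<Delta>z / 2) * (\<Sum>i\<in>UNIV. \<Sum>k\<in>UNIV. \<Sum>\<eta>\<in>UNIV. p i k \<eta> * (h i * h k))"

lemma face_quad_add:
  "face_quad \<Delta>y \<Delta>z h (\<lambda>i k \<eta>. p i k \<eta> + r i k \<eta>) = face_quad \<Delta>y \<Delta>z h p + face_quad \<Delta>y \<Delta>z h r"
  by (simp add: face_quad_def distrib_left distrib_right sum.distrib)

lemma face_quad_diff:
  "face_quad \<Delta>y \<Delta>z h (\<lambda>i k \<eta>. p i k \<eta> - r i k \<eta>) = face_quad \<Delta>y \<Delta>z h p - face_quad \<Delta>y \<Delta>z h r"
  by (simp add: face_quad_def left_diff_distrib right_diff_distrib sum_subtractf)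

lemma face_quad_double:
  "face_quad \<Delta>y \<Delta>z h (\<lambda>i k \<eta>. 2 * p i k \<eta>) = 2 * face_quad \<Delta>y \<Delta>z h p"
  by (simp add: face_quad_def sum_distrib_left mult_ac)

lemma Re_face_sum: "Re (face_sum \<Delta>y \<Delta>z h g) = face_quad \<Delta>y \<Delta>z h (\<lambda>i k \<eta>. Re (g i k \<eta>))"
  unfolding face_sum_def face_quad_def by simp

lemma Re_cdot_Wface:
  assumes "\<And>i k. Re (cdot (node t i k) (node y i k)) = (\<Sum>\<eta>\<in>UNIV. p i k \<eta>)"
  shows "Re (cdot t (cmat (Wface \<Delta>y \<Delta>z h) *v y)) = face_quad \<Delta>y \<Delta>z h p"
  unfolding cdot_Wface face_quad_def using assms by (simp add: sum_distrib_right)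

lemma Re_boundary_form:
  "Re (cdot (trace_x q \<psi> Q) (cmat (Wface \<Delta>y \<Delta>z h) *v (cmat Aface *v trace_x q \<psi> Q)))
    = 2 * face_quad \<Delta>y \<Delta>z h (\<lambda>i k \<eta>. Re (cnj (vel q \<psi> Q i k $ \<eta>) * trac q \<psi> Q i k $ \<eta>))"
  unfolding face_quad_double[symmetric]
proof (rule Re_cdot_Wface)
  fix i k
  have "Re (cdot (vel q \<psi> Q i k) (trac q \<psi> Q i k) + cdot (trac q \<psi> Q i k) (vel q \<psi> Q i k))
      = 2 * Re (cdot (vel q \<psi> Q i k) (trac q \<psi> Q i k))"
    using cnj_cdot[of "vel q \<psi> Q i k" "trac q \<psi> Q i k"] by (metis complex_add_cnj Re_complex_of_real)
  then show "Re (cdot (node (trace_x q \<psi> Q) i k) (node (cmat Aface *v trace_x q \<psi> Q) i k))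
      = (\<Sum>\<eta>\<in>UNIV. 2 * Re (cnj (vel q \<psi> Q i k $ \<eta>) * trac q \<psi> Q i k $ \<eta>))"
    unfolding node_Aface trace_A9_trace by (simp only: cdot_def Re_sum sum_distrib_left)
qed

lemma Re_flux_form_FR:
  assumes "\<And>\<eta>. impedance M \<eta> \<noteq> 0"
  shows "Re (cdot (trace_x q \<psi> Q) (cmat (Wface \<Delta>y \<Delta>z h) *v FR M G))
    = face_quad \<Delta>y \<Delta>z h (\<lambda>i k \<eta>. Re (cnj (vel q \<psi> Q i k $ \<eta>) * G i k $ \<eta>
        + cnj (trac q \<psi> Q i k $ \<eta>) * G i k $ \<eta> / of_real (impedance M \<eta>)))"
  by (rule Re_cdot_Wface) (simp only: trace_FR[OF assms] Re_sum)

lemma Re_flux_form_FL: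
  assumes "\<And>\<eta>. impedance M \<eta> \<noteq> 0"
  shows "Re (cdot (trace_x q \<psi> Q) (cmat (Wface \<Delta>y \<Delta>z h) *v FL M G))
    = face_quad \<Delta>y \<Delta>z h (\<lambda>i k \<eta>. Re (cnj (vel q \<psi> Q i k $ \<eta>) * G i k $ \<eta>
        - cnj (trac q \<psi> Q i k $ \<eta>) * G i k $ \<eta> / of_real (impedance M \<eta>)))"
  by (rule Re_cdot_Wface) (simp only: trace_FL[OF assms] Re_sum)

lemma impedance_pos: "valid_medium M \<Longrightarrow> impedance M \<eta> > 0"
  by (cases \<eta>) (auto simp: impedance_def valid_medium_def)

text \<open>On the right face the boundary form and the flux combine, node by node, to the product of the hat
  variables and a negative square.\<close>

lemma right_face_sum:
  fixes vh Th G :: "'n::finite face_vec"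
  assumes M: "valid_medium M"
    and hat: "\<And>i k \<eta>. of_real (impedance M \<eta>) * vh i k $ \<eta> - Th i k $ \<eta>
        = of_real (impedance M \<eta>) * vel q 1 Q i k $ \<eta> - trac q 1 Q i k $ \<eta>"
    and G: "G = fluctuation 1 (impedance M) (vel q 1 Q) (trac q 1 Q) vh Th"
  shows "Re (cdot (trace_x q 1 Q) (cmat (Wface \<Delta>y \<Delta>z h) *v (cmat Aface *v trace_x q 1 Q))) / 2
      - Re (cdot (trace_x q 1 Q) (cmat (Wface \<Delta>y \<Delta>z h) *v FR M G))
    = Re (face_sum \<Delta>y \<Delta>z h (\<lambda>i k \<eta>. cnj (Th i k $ \<eta>) * vh i k $ \<eta>))
      - face_quad \<Delta>y \<Delta>z h (\<lambda>i k \<eta>. 1 / impedance M \<eta> * (cmod (G i k $ \<eta>))\<^sup>2)"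
proof -
  have half: "2 * x / 2 = x" for x :: real by simp
  note Z = impedance_pos[OF M]
  have Z0: "impedance M \<eta> \<noteq> 0" for \<eta>
    using Z[of \<eta>] by (rule less_imp_neq[THEN not_sym])
  have "Re (cnj (vel q 1 Q i k $ \<eta>) * trac q 1 Q i k $ \<eta>)
        - Re (cnj (vel q 1 Q i k $ \<eta>) * G i k $ \<eta>
          + cnj (trac q 1 Q i k $ \<eta>) * G i k $ \<eta> / of_real (impedance M \<eta>))
      = Re (cnj (Th i k $ \<eta>) * vh i k $ \<eta>) - 1 / impedance M \<eta> * (cmod (G i k $ \<eta>))\<^sup>2" for i k \<eta>
    by (rule right_face_balance[OF Z hat]) (simp add: G fluctuation_def)
  then show ?thesis
    unfolding Re_boundary_form Re_flux_form_FR[OF Z0] Re_face_sum half face_quad_diff[symmetric]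
    by (simp only:)
qed

text \<open>On the left face the boundary form enters the energy balance with a minus sign, because the
  outward normal is reversed; hence the two plus signs here.\<close>

lemma left_face_sum:
  fixes vh Th G :: "'n::finite face_vec"
  assumes M: "valid_medium M"
    and hat: "\<And>i k \<eta>. of_real (impedance M \<eta>) * vh i k $ \<eta> + Th i k $ \<eta>
        = of_real (impedance M \<eta>) * vel q (-1) Q i k $ \<eta> + trac q (-1) Q i k $ \<eta>"
    and G: "G = fluctuation (-1) (impedance M) (vel q (-1) Q) (trac q (-1) Q) vh Th"
  shows "Re (cdot (trace_x q (-1) Q) (cmat (Wface \<Delta>y \<Delta>z h) *v (cmat Aface *v trace_x q (-1) Q))) / 2
      + Re (cdot (trace_x q (-1) Q) (cmat (Wface \<Delta>y \<Delta>z h) *v FL M G))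
    = Re (face_sum \<Delta>y \<Delta>z h (\<lambda>i k \<eta>. cnj (Th i k $ \<eta>) * vh i k $ \<eta>))
      + face_quad \<Delta>y \<Delta>z h (\<lambda>i k \<eta>. 1 / impedance M \<eta> * (cmod (G i k $ \<eta>))\<^sup>2)"
proof -
  have half: "2 * x / 2 = x" for x :: real by simp
  note Z = impedance_pos[OF M]
  have Z0: "impedance M \<eta> \<noteq> 0" for \<eta>
    using Z[of \<eta>] by (rule less_imp_neq[THEN not_sym])
  have negate: "a + b = c + d" if "- a - b = - c - d" for a b c d :: real
    using that by simp
  have "Re (cnj (vel q (-1) Q i k $ \<eta>) * trac q (-1) Q i k $ \<eta>)
        + Re (cnj (vel q (-1) Q i k $ \<eta>) * G i k $ \<eta>
          - cnj (trac q (-1) Q i k $ \<eta>) * G i k $ \<eta> / of_real (impedance M \<eta>))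
      = Re (cnj (Th i k $ \<eta>) * vh i k $ \<eta>) + 1 / impedance M \<eta> * (cmod (G i k $ \<eta>))\<^sup>2" for i k \<eta>
    by (rule negate, rule left_face_balance[OF Z hat]) (simp add: G fluctuation_def)
  then show ?thesis
    unfolding Re_boundary_form Re_flux_form_FL[OF Z0] Re_face_sum half face_quad_add[symmetric]
    by (simp only:)
qed

lemma Re_F_luc:
  "Re (F_luc \<Delta>y \<Delta>z h Zi GL GR)
    = - face_quad \<Delta>y \<Delta>z h (\<lambda>i k \<eta>. 1 / Zi \<eta> * (cmod (GL i k $ \<eta>))\<^sup>2)
      - face_quad \<Delta>y \<Delta>z h (\<lambda>i k \<eta>. 1 / Zi \<eta> * (cmod (GR i k $ \<eta>))\<^sup>2)"
  unfolding F_luc_def uminus_complex.simps Re_face_sum Re_complex_of_real face_quad_add by simp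

text \<open>The quadratic identity behind the estimate. The hat variables enter through the
  outgoing characteristic that they share with the traces, at external faces and at the interface
  alike.\<close>

lemma element_energy_balance:
  fixes q h :: "'n::finite \<Rightarrow> real" and vhL ThL vhR ThR GL GR :: "'n face_vec"
  assumes h: "\<And>i. h i > 0" and \<Delta>: "\<Delta>x > 0" "\<Delta>y > 0" "\<Delta>z > 0" and M: "valid_medium M"
    and eqn: "pml_equation \<Delta>x q h d \<alpha> s M Q GL GR F"
    and hatL: "\<And>i k \<eta>. of_real (impedance M \<eta>) * vhL i k $ \<eta> + ThL i k $ \<eta>
        = of_real (impedance M \<eta>) * vel q (-1) Q i k $ \<eta> + trac q (-1) Q i k $ \<eta>"
    and hatR: "\<And>i k \<eta>. of_real (impedance M \<eta>) * vhR i k $ \<eta> - ThR i k $ \<eta>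
        = of_real (impedance M \<eta>) * vel q 1 Q i k $ \<eta> - trac q 1 Q i k $ \<eta>"
    and GL: "GL = fluctuation (-1) (impedance M) (vel q (-1) Q) (trac q (-1) Q) vhL ThL"
    and GR: "GR = fluctuation 1 (impedance M) (vel q 1 Q) (trac q 1 Q) vhR ThR"
  shows "Re (s * pml_S d \<alpha> s) * Re (hP_inner \<Delta>x \<Delta>y \<Delta>z h M Q Q)
    = Re (hP_inner \<Delta>x \<Delta>y \<Delta>z h M Q F)
      + 1/2 * Re (face_sum \<Delta>y \<Delta>z h (\<lambda>i k \<eta>. cnj (ThR i k $ \<eta>) * vhR i k $ \<eta>)
          - face_sum \<Delta>y \<Delta>z h (\<lambda>i k \<eta>. cnj (ThL i k $ \<eta>) * vhL i k $ \<eta>)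
          + F_luc \<Delta>y \<Delta>z h (impedance M) GL GR)"
proof -
  let ?t = "\<lambda>\<psi>. trace_x q \<psi> Q"
  let ?b = "\<lambda>\<psi>. cdot (?t \<psi>) (cmat (Wface \<Delta>y \<Delta>z h) *v (cmat Aface *v ?t \<psi>))"
  let ?K = "Ax ** Dx \<Delta>x q h - matrix_inv (Hx \<Delta>x h) ** Ax ** transpose (Dx \<Delta>x q h) ** Hx \<Delta>x h"
  have skew: "Re (cdot Q (cmat (Hxyz \<Delta>x \<Delta>y \<Delta>z h ** ?K) *v Q)) = 0"
    unfolding volume_term_skew[OF h \<Delta>(1)] by (rule Re_cdot_skew_part)
  have Im0: "Im (hP_inner \<Delta>x \<Delta>y \<Delta>z h M Q Q) = 0"
    using cdot_pos_semidef(1)[OF pos_semidef_energy_matrix[OF h \<Delta> M]] by (simp add: hP_inner_eq_cdot)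
  have "Re (2 * (c * x)) = 2 * (Re c * Re x)" if "Im x = 0" for c x :: complex
    using that by simp
  then have "2 * (Re (s * pml_S d \<alpha> s) * Re (hP_inner \<Delta>x \<Delta>y \<Delta>z h M Q Q))
      = (Re (?b 1) - Re (?b (-1))) / 2
        - (Re (cdot (?t (-1)) (cmat (Wface \<Delta>y \<Delta>z h) *v FL M GL))
          + Re (cdot (?t 1) (cmat (Wface \<Delta>y \<Delta>z h) *v FR M GR)))
        + 2 * Re (hP_inner \<Delta>x \<Delta>y \<Delta>z h M Q F)"
    using arg_cong[OF element_weak_form[OF h \<Delta>(1) eqn, of \<Delta>y \<Delta>z], of Re] Im0 by (simp add: skew)
  then show ?thesis
    using right_face_sum[OF M hatR GR, of \<Delta>y \<Delta>z h] left_face_sum[OF M hatL GL, of \<Delta>y \<Delta>z h]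
      Re_F_luc[of \<Delta>y \<Delta>z h "impedance M" GL GR]
    by (simp only: plus_complex.simps minus_complex.simps) argo
qed

section \<open>Dissipation\<close>

lemma face_sum_nonpos_real:
  assumes "\<And>i. h i > 0" and "\<Delta>y > 0" "\<Delta>z > 0"
    and "\<And>i k \<eta>. g i k \<eta> \<in> \<real>" and "\<And>i k \<eta>. Re (g i k \<eta>) \<le> 0"
  shows "face_sum \<Delta>y \<Delta>z h g \<in> \<real>" and "Re (face_sum \<Delta>y \<Delta>z h g) \<le> 0"
proof -
  show "face_sum \<Delta>y \<Delta>z h g \<in> \<real>"
    unfolding face_sum_def using assms(4) by (intro Reals_mult sum_in_Reals Reals_of_real)
  have "(\<Sum>i\<in>UNIV. \<Sum>k\<in>UNIV. \<Sum>\<eta>\<in>UNIV. Re (g i k \<eta>) * (h i * h k)) \<le> 0"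
    using assms by (intro sum_nonpos mult_nonpos_nonneg) (auto intro: less_imp_le)
  then show "Re (face_sum \<Delta>y \<Delta>z h g) \<le> 0"
    using assms unfolding face_sum_def by (simp add: mult_nonneg_nonpos)
qed

text \<open>The boundary condition gives \<open>Th = - \<zeta> (1 - \<gamma>) / (1 + \<gamma>) vh\<close> with a nonpositive real factor. For
  \<open>\<gamma> = -1\<close> this breaks down, but then the condition says \<open>vh = 0\<close>.\<close>

lemma reflecting_face_dissipative:
  fixes vh Th :: complex
  assumes z: "\<zeta> > 0" and \<gamma>: "\<bar>\<gamma>\<bar> \<le> 1"
    and bc: "of_real (\<zeta> / 2 * (1 - \<gamma>)) * vh + of_real ((1 + \<gamma>) / 2) * Th = 0"
  shows "cnj Th * vh \<in> \<real>" and "Re (cnj Th * vh) \<le> 0"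
proof -
  have "\<exists>r\<le>0. cnj Th * vh = of_real r"
  proof (cases "\<gamma> = -1")
    case True
    then have "vh = 0" using bc z by simp
    then show ?thesis by (intro exI[of _ 0]) simp
  next
    case False
    then have p: "1 + \<gamma> > 0" using \<gamma> by auto
    have "Th = of_real (- (\<zeta> * (1 - \<gamma>) / (1 + \<gamma>))) * vh"
    proof -
      have "of_real (1 + \<gamma>) * Th = - (of_real (\<zeta> * (1 - \<gamma>)) * vh)"
      proof -
        have halves: "of_real x * vh + of_real y * Th = 2 * (of_real (x / 2) * vh + of_real (y / 2) * Th)"
          for x y
          by (simp add: distrib_left)
        have "of_real (\<zeta> * (1 - \<gamma>)) * vh + of_real (1 + \<gamma>) * Th = 0"
          using halves[of "\<zeta> * (1 - \<gamma>)" "1 + \<gamma>"] bc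
          by (simp only: times_divide_eq_left mult_zero_right)
        then show ?thesis by (simp only: add_eq_0_iff)
      qed
      then show ?thesis using p by (simp add: field_simps del: of_real_add of_real_diff)
    qed
    then have "cnj Th * vh = of_real (- (\<zeta> * (1 - \<gamma>) / (1 + \<gamma>)) * (cmod vh)\<^sup>2)"
      by (simp add: complex_norm_square mult_ac del: of_real_power)
    moreover have "- (\<zeta> * (1 - \<gamma>) / (1 + \<gamma>)) * (cmod vh)\<^sup>2 \<le> 0"
      using p z \<gamma> by simp
    ultimately show ?thesis by blast
  qed
  then show "cnj Th * vh \<in> \<real>" and "Re (cnj Th * vh) \<le> 0"
    by (metis Reals_of_real, metis Re_complex_of_real)
qed

text \<open>The added term is \<open>d s / (s + \<alpha>)\<close>, and multiplying numerator and denominator by the conjugate of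
  the denominator gives \<open>s (s\<^sup>* + \<alpha>)\<close>, whose real part \<open>|s|\<^sup>2 + \<alpha> Re s\<close> is nonnegative.\<close>

lemma Re_pml_stretched_frequency:
  assumes "d \<ge> 0" "\<alpha> \<ge> 0" "Re s \<ge> 0"
  shows "Re s \<le> Re (s * pml_S d \<alpha> s)"
proof -
  have "0 \<le> Re (s / (s + of_real \<alpha>))"
    using assms by (simp add: Re_divide)
  moreover have "Re (of_real d * w) = d * Re w" for w
    by simp
  ultimately have "0 \<le> Re (of_real d * (s / (s + of_real \<alpha>)))"
    using assms(1) by (simp only: mult_nonneg_nonneg)
  moreover have "s * pml_S d \<alpha> s = s + of_real d * (s / (s + of_real \<alpha>))"
    by (simp add: pml_S_def algebra_simps)
  ultimately show ?thesis by simp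
qed

theorem theorem7:
  fixes N :: nat and q h :: "'n::finite \<Rightarrow> real"
    and \<Delta>x \<Delta>y \<Delta>z d \<alpha> a :: real and s S :: complex
    and Mm Mp :: medium
    and \<gamma>L \<gamma>R :: "axis \<Rightarrow> real"
    and Qm Qp FQm FQp Fwm Fwp Fm Fp :: "complex ^ 'n dof"
    and vhL ThL vhIm vhIp ThI vhR ThR GmL GmR GpL GpR :: "'n face_vec"
    and BT :: complex
  assumes quad: "is_quadrature N q h"
    and edges: "\<Delta>x > 0" "\<Delta>y > 0" "\<Delta>z > 0"
    and media: "valid_medium Mm" "valid_medium Mp"
    and reflection: "\<And>\<eta>. \<bar>\<gamma>L \<eta>\<bar> \<le> 1" "\<And>\<eta>. \<bar>\<gamma>R \<eta>\<bar> \<le> 1"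
    and pml: "d \<ge> 0" "\<alpha> \<ge> 0" "S = pml_S d \<alpha> s"
    and s: "Re s \<ge> a" "a > 0"
    and source:
      "Fm = pml_source d \<alpha> s Mm FQm Fwm"
      "Fp = pml_source d \<alpha> s Mp FQp Fwp"
    and hats:
      "hat_left_boundary (impedance Mm) \<gamma>L (vel q (-1) Qm) (trac q (-1) Qm) vhL ThL"
      "hat_interface (impedance Mm) (impedance Mp)
         (vel q 1 Qm) (trac q 1 Qm) (vel q (-1) Qp) (trac q (-1) Qp) vhIm vhIp ThI"
      "hat_right_boundary (impedance Mp) \<gamma>R (vel q 1 Qp) (trac q 1 Qp) vhR ThR"
    and G:
      "GmL = fluctuation (-1) (impedance Mm) (vel q (-1) Qm) (trac q (-1) Qm) vhL ThL"
      "GmR = fluctuation 1 (impedance Mm) (vel q 1 Qm) (trac q 1 Qm) vhIm ThI"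
      "GpL = fluctuation (-1) (impedance Mp) (vel q (-1) Qp) (trac q (-1) Qp) vhIp ThI"
      "GpR = fluctuation 1 (impedance Mp) (vel q 1 Qp) (trac q 1 Qp) vhR ThR"
    and eqn:
      "pml_equation \<Delta>x q h d \<alpha> s Mm Qm GmL GmR Fm"
      "pml_equation \<Delta>x q h d \<alpha> s Mp Qp GpL GpR Fp"
    and BT: "BT = BT_minus \<Delta>y \<Delta>z h vhL ThL + BT_plus \<Delta>y \<Delta>z h vhR ThR
                + IT \<Delta>y \<Delta>z h vhIm vhIp ThI
                + F_luc \<Delta>y \<Delta>z h (impedance Mm) GmL GmR + F_luc \<Delta>y \<Delta>z h (impedance Mp) GpL GpR"
  shows "Re (s * S) \<ge> a \<and> a > 0 \<and>
    (hP_norm \<Delta>x \<Delta>y \<Delta>z h Mm (complex_of_real (sqrt (Re (s * S))) *s Qm))\<^sup>2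
      + (hP_norm \<Delta>x \<Delta>y \<Delta>z h Mp (complex_of_real (sqrt (Re (s * S))) *s Qp))\<^sup>2
    \<le> hP_norm \<Delta>x \<Delta>y \<Delta>z h Mm Qm * hP_norm \<Delta>x \<Delta>y \<Delta>z h Mm Fm
      + hP_norm \<Delta>x \<Delta>y \<Delta>z h Mp Qp * hP_norm \<Delta>x \<Delta>y \<Delta>z h Mp Fp
      + 1/2 * Re BT \<and>
    BT \<in> \<real> \<and> Re BT \<le> 0"
proof (intro conjI)
  have h: "h i > 0" for i
    using quad by (simp add: is_quadrature_def)
  show sS: "Re (s * S) \<ge> a"
    using Re_pml_stretched_frequency[OF pml(1,2), of s] s pml(3) by simp
  show "a > 0" by (rule s(2))
  have IT0: "IT \<Delta>y \<Delta>z h vhIm vhIp ThI = 0"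
    using hats(2) by (simp add: IT_def face_sum_def hat_interface_def)
  let ?fs = "\<lambda>Th vh. face_sum \<Delta>y \<Delta>z h (\<lambda>i k \<eta>. cnj (Th i k $ \<eta>) * vh i k $ \<eta>)"
  let ?n = "hP_norm \<Delta>x \<Delta>y \<Delta>z h" and ?ip = "hP_inner \<Delta>x \<Delta>y \<Delta>z h"
  have "Re (s * S) * Re (?ip Mm Qm Qm) = Re (?ip Mm Qm Fm)
      + 1/2 * Re (?fs ThI vhIm - ?fs ThL vhL + F_luc \<Delta>y \<Delta>z h (impedance Mm) GmL GmR)"
    using hats(1,2) unfolding pml(3) hat_left_boundary_def hat_interface_def
    by (intro element_energy_balance[OF h edges media(1) eqn(1) _ _ G(1,2)]) blast+
  moreover have "Re (s * S) * Re (?ip Mp Qp Qp) = Re (?ip Mp Qp Fp)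
      + 1/2 * Re (?fs ThR vhR - ?fs ThI vhIp + F_luc \<Delta>y \<Delta>z h (impedance Mp) GpL GpR)"
    using hats(2,3) unfolding pml(3) hat_right_boundary_def hat_interface_def
    by (intro element_energy_balance[OF h edges media(2) eqn(2) _ _ G(3,4)]) blast+
  moreover have "?fs ThI vhIp = ?fs ThI vhIm"
    using hats(2) by (simp add: hat_interface_def)
  ultimately have "Re (s * S) * Re (?ip Mm Qm Qm) + Re (s * S) * Re (?ip Mp Qp Qp)
      = Re (?ip Mm Qm Fm) + Re (?ip Mp Qp Fp) + 1/2 * Re BT"
    unfolding BT IT0 BT_minus_def BT_plus_def
    by (simp only: plus_complex.simps minus_complex.simps uminus_complex.simps add_0_right) argo
  moreover have "Re (?ip Mm Qm Fm) \<le> ?n Mm Qm * ?n Mm Fm"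
    by (rule hP_norm_Cauchy_Schwarz[OF h edges media(1)])
  moreover have "Re (?ip Mp Qp Fp) \<le> ?n Mp Qp * ?n Mp Fp"
    by (rule hP_norm_Cauchy_Schwarz[OF h edges media(2)])
  moreover have "Re (s * S) \<ge> 0" using sS s(2) by simp
  ultimately show "(?n Mm (complex_of_real (sqrt (Re (s * S))) *s Qm))\<^sup>2
      + (?n Mp (complex_of_real (sqrt (Re (s * S))) *s Qp))\<^sup>2
    \<le> ?n Mm Qm * ?n Mm Fm + ?n Mp Qp * ?n Mp Fp + 1/2 * Re BT"
    by (simp only: hP_norm_scale_sqrt[OF h edges media(1)] hP_norm_scale_sqrt[OF h edges media(2)])
  have nonpos: "z \<in> \<real> \<and> Re z \<le> 0" if "z = face_sum \<Delta>y \<Delta>z h g"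
    and "\<And>i k \<eta>. g i k \<eta> \<in> \<real> \<and> Re (g i k \<eta>) \<le> 0" for z g
    using face_sum_nonpos_real[of h \<Delta>y \<Delta>z g] h edges(2,3) that by blast
  have "BT_minus \<Delta>y \<Delta>z h vhL ThL \<in> \<real> \<and> Re (BT_minus \<Delta>y \<Delta>z h vhL ThL) \<le> 0"
  proof (rule nonpos)
    \<comment> \<open>With \<open>- ThL\<close> for \<open>ThL\<close> the condition at \<open>\<psi> = -1\<close> takes the form of the one at \<open>\<psi> = 1\<close>.\<close>
    show "BT_minus \<Delta>y \<Delta>z h vhL ThL = face_sum \<Delta>y \<Delta>z h (\<lambda>i k \<eta>. cnj (- (ThL i k $ \<eta>)) * vhL i k $ \<eta>)"
      by (simp add: BT_minus_def face_sum_def sum_negf)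
    show "cnj (- (ThL i k $ \<eta>)) * vhL i k $ \<eta> \<in> \<real> \<and> Re (cnj (- (ThL i k $ \<eta>)) * vhL i k $ \<eta>) \<le> 0" for i k \<eta>
      using reflecting_face_dissipative[OF impedance_pos[OF media(1)] reflection(1), of \<eta> \<eta> "vhL i k $ \<eta>" "- (ThL i k $ \<eta>)"]
        hats(1) by (simp add: hat_left_boundary_def)
  qed
  moreover have "BT_plus \<Delta>y \<Delta>z h vhR ThR \<in> \<real> \<and> Re (BT_plus \<Delta>y \<Delta>z h vhR ThR) \<le> 0"
  proof (rule nonpos)
    show "BT_plus \<Delta>y \<Delta>z h vhR ThR = face_sum \<Delta>y \<Delta>z h (\<lambda>i k \<eta>. cnj (ThR i k $ \<eta>) * vhR i k $ \<eta>)"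
      by (simp add: BT_plus_def)
    show "cnj (ThR i k $ \<eta>) * vhR i k $ \<eta> \<in> \<real> \<and> Re (cnj (ThR i k $ \<eta>) * vhR i k $ \<eta>) \<le> 0" for i k \<eta>
      using reflecting_face_dissipative[OF impedance_pos[OF media(2)] reflection(2), of \<eta> \<eta> "vhR i k $ \<eta>" "ThR i k $ \<eta>"]
        hats(3) by (simp add: hat_right_boundary_def)
  qed
  moreover have "F_luc \<Delta>y \<Delta>z h (impedance M) GL GR \<in> \<real> \<and> Re (F_luc \<Delta>y \<Delta>z h (impedance M) GL GR) \<le> 0"
    if "valid_medium M" for M and GL GR :: "'n face_vec"
  proof (rule nonpos)
    show "F_luc \<Delta>y \<Delta>z h (impedance M) GL GR = face_sum \<Delta>y \<Delta>z h (\<lambda>i k \<eta>.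
        of_real (- (1 / impedance M \<eta> * (cmod (GL i k $ \<eta>))\<^sup>2 + 1 / impedance M \<eta> * (cmod (GR i k $ \<eta>))\<^sup>2)))"
      unfolding F_luc_def face_sum_def of_real_minus by (simp only: mult_minus_left sum_negf mult_minus_right)
    show "of_real (- (1 / impedance M \<eta> * (cmod (GL i k $ \<eta>))\<^sup>2 + 1 / impedance M \<eta> * (cmod (GR i k $ \<eta>))\<^sup>2)) \<in> \<real>
        \<and> Re (of_real (- (1 / impedance M \<eta> * (cmod (GL i k $ \<eta>))\<^sup>2 + 1 / impedance M \<eta> * (cmod (GR i k $ \<eta>))\<^sup>2))) \<le> 0"
      for i k \<eta>
      unfolding Re_complex_of_real using impedance_pos[OF that, of \<eta>] 
      by (simp only: Reals_of_real neg_le_0_iff_le simp_thms)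
        (intro add_nonneg_nonneg mult_nonneg_nonneg, auto)
  qed
  ultimately show "BT \<in> \<real>" and "Re BT \<le> 0"
    unfolding BT IT0 using media by (auto intro!: Reals_add add_nonpos_nonpos)
qed

end
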